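(* Let $\Phi$ be a uniformly absolutely convergent interaction on $X=E^{\mathbb{Z}}$ ($E$ finite). Assume: (1) $\Phi$ satisfies the Dobrushin condition $\bar c(\Phi)<1$; (2) $\sum_{k=1}^\infty\|\underline\delta(\Phi_{\Lambda_k})\|_2^2<\infty$; (3) $\sum_{k=1}^\infty\rho^\mu_k<\infty$, where $\rho^\mu_k:=\sup_{n\in\mathbb{N}}\big|\int_X\Phi_{\Lambda_k}d\mu^{(n)}\big|$. Then $\Psi^{(0)}$ has a unique Gibbs measure $\nu^{(0)}$, the family $\{f^{(k)}_\mu:k\in\mathbb{N}\}$ is uniformly integrable in $L^1(\mu)$, and $\nu^{(0)}\ll\mu$.
   Context: An interaction $\Phi=(\Phi_\Lambda)_{\Lambda\Subset\mathbb{Z}}$ consists of functions $\Phi_\Lambda$ on $X$ depending only on coordinates in $\Lambda$; UAC means $\sup_i\sum_{V\ni i}\|\Phi_V\|_\infty<\infty$. Gibbs measures for $\Phi$ are probabilities consistent with $\gamma^\Phi_\Lambda(\omega_\Lambda|\eta_{\Lambda^c})=e^{-H^\Phi_\Lambda(\omega_\Lambda\eta_{\Lambda^c})}/\sum_{\bar\omega_\Lambda}e^{-H^\Phi_\Lambda(\bar\omega_\Lambda\eta_{\Lambda^c})}$, $H^\Phi_\Lambda=\sum_{V\cap\Lambda\ne\emptyset}\Phi_V$. Dobrushin condition: $\bar c(\Phi)=\frac12\sup_i\sum_{\Lambda\ni i}(|\Lambda|-1)\delta(\Phi_\Lambda)<1$, $\delta(f)=\sup_{\xi,\eta}|f(\xi)-f(\eta)|$;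 it implies a unique Gibbs measure. $\delta_kF=\sup\{F(\xi)-F(\eta):\xi_j=\eta_j\ \forall j\ne k\}$, $\|\underline\delta(F)\|_2^2=\sum_k(\delta_kF)^2$. Let $\mathcal A=\{\Lambda\Subset\mathbb{Z}:\min\Lambda<0\le\max\Lambda\}=\{\Lambda_1,\Lambda_2,\dots\}$ (fixed enumeration). $\Psi^{(0)}_\Lambda=0$ for $\Lambda\in\mathcal A$ and $=\Phi_\Lambda$ otherwise. For $k\ge0$, $\Phi^{(k)}_\Lambda=0$ if $\Lambda\in\{\Lambda_i:1\le i\le k\}$ and $\Phi^{(k)}_\Lambda=\Phi_\Lambda$ otherwise; under the Dobrushin condition each $\Phi^{(k)}$ has a unique Gibbs measure $\mu^{(k)}$. $\mu$ denotes the unique Gibbs measure of $\Phi$, and $f^{(k)}_\mu:=\frac{d\mu^{(k)}}{d\mu}=e^{\sum_{i=1}^k\Phi_{\Lambda_i}}/\int_Xe^{\sum_{i=1}^k\Phi_{\Lambda_i}}d\mu$. *)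

theory Defs
  imports "HOL-Probability.Probability"
begin

definition Xsp :: "(int \<Rightarrow> 'e::finite) measure" where
  "Xsp = PiM UNIV (\<lambda>_::int. count_space (UNIV::'e set))"

type_synonym 'e interaction = "int set \<Rightarrow> (int \<Rightarrow> 'e) \<Rightarrow> real"

text \<open>An interaction: for every finite Lambda, Phi Lambda depends only on coordinates in Lambda.
  (Values on infinite sets are never used.)\<close>
definition interaction :: "'e interaction \<Rightarrow> bool" where
  "interaction Phi \<longleftrightarrow> (\<forall>L. finite L \<longrightarrow>
      (\<forall>\<omega> \<eta>. (\<forall>i\<in>L. \<omega> i = \<eta> i) \<longrightarrow> Phi L \<omega> = Phi L \<eta>))"

definition supnorm :: "((int \<Rightarrow> 'e) \<Rightarrow> real) \<Rightarrow> real" where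
  "supnorm f = (SUP \<omega>. \<bar>f \<omega>\<bar>)"

definition UAC :: "'e interaction \<Rightarrow> bool" where
  "UAC Phi \<longleftrightarrow> (\<exists>C. \<forall>i.
      (\<lambda>V. supnorm (Phi V)) summable_on {V. finite V \<and> i \<in> V} \<and>
      (\<Sum>\<^sub>\<infinity>V\<in>{V. finite V \<and> i \<in> V}. supnorm (Phi V)) \<le> C)"

definition hamiltonian :: "'e interaction \<Rightarrow> int set \<Rightarrow> (int \<Rightarrow> 'e) \<Rightarrow> real" where
  "hamiltonian Phi L \<omega> = (\<Sum>\<^sub>\<infinity>V\<in>{V. finite V \<and> V \<inter> L \<noteq> {}}. Phi V \<omega>)"

definition cupd :: "int set \<Rightarrow> (int \<Rightarrow> 'e) \<Rightarrow> (int \<Rightarrow> 'e) \<Rightarrow> (int \<Rightarrow> 'e)" where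
  "cupd L \<sigma> \<eta> = (\<lambda>i. if i \<in> L then \<sigma> i else \<eta> i)"

definition gamma :: "'e::finite interaction \<Rightarrow> int set \<Rightarrow> (int \<Rightarrow> 'e) set \<Rightarrow> (int \<Rightarrow> 'e) \<Rightarrow> real" where
  "gamma Phi L A \<eta> =
     (\<Sum>\<sigma>\<in>PiE L (\<lambda>_. UNIV). indicator A (cupd L \<sigma> \<eta>) * exp (- hamiltonian Phi L (cupd L \<sigma> \<eta>)))
     / (\<Sum>\<sigma>\<in>PiE L (\<lambda>_. UNIV). exp (- hamiltonian Phi L (cupd L \<sigma> \<eta>)))"

definition gibbs :: "'e::finite interaction \<Rightarrow> (int \<Rightarrow> 'e) measure \<Rightarrow> bool" where
  "gibbs Phi \<mu> \<longleftrightarrow> prob_space \<mu> \<and> sets \<mu> = sets Xsp \<and>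
     (\<forall>L. finite L \<longrightarrow> (\<forall>A\<in>sets Xsp. measure \<mu> A = (\<integral>\<eta>. gamma Phi L A \<eta> \<partial>\<mu>)))"

definition osc :: "((int \<Rightarrow> 'e) \<Rightarrow> real) \<Rightarrow> real" where
  "osc f = (SUP p. \<bar>f (fst p) - f (snd p)\<bar>)"

definition dobrushin :: "'e interaction \<Rightarrow> bool" where
  "dobrushin Phi \<longleftrightarrow> (\<exists>c<1. \<forall>i.
      (\<lambda>L. (real (card L) - 1) * osc (Phi L)) summable_on {L. finite L \<and> i \<in> L} \<and>
      (1/2) * (\<Sum>\<^sub>\<infinity>L\<in>{L. finite L \<and> i \<in> L}. (real (card L) - 1) * osc (Phi L)) \<le> c)"

definition delta_at :: "((int \<Rightarrow> 'e) \<Rightarrow> real) \<Rightarrow> int \<Rightarrow> real" where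
  "delta_at F k = (SUP p \<in> {(\<xi>, \<eta>). \<forall>j. j \<noteq> k \<longrightarrow> \<xi> j = \<eta> j}. F (fst p) - F (snd p))"

definition delta_norm2_sq :: "((int \<Rightarrow> 'e) \<Rightarrow> real) \<Rightarrow> real" where
  "delta_norm2_sq F = (\<Sum>\<^sub>\<infinity>k\<in>(UNIV::int set). (delta_at F k)^2)"

definition crossing :: "int set set" where
  "crossing = {L. finite L \<and> L \<noteq> {} \<and> Min L < 0 \<and> 0 \<le> Max L}"

definition Psi0 :: "'e interaction \<Rightarrow> 'e interaction" where
  "Psi0 Phi L = (if L \<in> crossing then (\<lambda>_. 0) else Phi L)"

definition Phik :: "'e interaction \<Rightarrow> (nat \<Rightarrow> int set) \<Rightarrow> nat \<Rightarrow> 'e interaction" where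
  "Phik Phi Lam k L = (if L \<in> Lam ` {1..k} then (\<lambda>_. 0) else Phi L)"

definition fk :: "'e interaction \<Rightarrow> (nat \<Rightarrow> int set) \<Rightarrow> (int \<Rightarrow> 'e) measure \<Rightarrow> nat \<Rightarrow> (int \<Rightarrow> 'e) \<Rightarrow> real" where
  "fk Phi Lam \<mu> k \<omega> = exp (\<Sum>i=1..k. Phi (Lam i) \<omega>) / (\<integral>\<xi>. exp (\<Sum>i=1..k. Phi (Lam i) \<xi>) \<partial>\<mu>)"

definition unif_integrable :: "'a measure \<Rightarrow> ('i \<Rightarrow> 'a \<Rightarrow> real) \<Rightarrow> bool" where
  "unif_integrable M F \<longleftrightarrow> (\<forall>n. integrable M (F n)) \<and>
     (\<forall>\<epsilon>>0. \<exists>C. \<forall>n. (\<integral>x. indicator {x. \<bar>F n x\<bar> > C} x * \<bar>F n x\<bar> \<partial>M) \<le> \<epsilon>)"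

end

theory Submission
  imports Defs "HOL-Complex_Analysis.Great_Picard"
begin

text \<open>The density \<open>fk k\<close> of \<open>\<mu>k k\<close> with respect to \<open>\<mu>\<close> is a Gibbs factor of the removed energy
  \<open>F\<close>, so by Jensen's inequality the relative entropy of \<open>\<mu>k k\<close> is at most
  \<open>\<integral> F d\<mu>k - \<integral> F d\<mu>\<close>, which the summability of the \<open>\<rho>\<close>'s bounds uniformly in \<open>k\<close>; a uniform
  entropy bound gives uniform integrability. Uniform integrability in turn makes
  setwise limits along a diagonal subsequence countably additive and absolutely continuous, and
  since the specifications converge uniformly, such a limit is a Gibbs measure for \<open>Psi0 Phi\<close>.
  Uniqueness, also needed to identify \<open>\<mu>k k\<close> with \<open>fk k \<mu>\<close>, is Dobrushin's theorem, proved by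
  sweeping over finitely many sites: each resampling contracts the total oscillation.\<close>

section \<open>Perturbation of finite Gibbs averages\<close>

text \<open>The sup norms of the crossing terms need not be summable over all of
  \<open>crossing\<close>: uniform absolute convergence controls only the sets meeting a fixed
  finite volume. The removed energy and the densities therefore need not have bounds uniform in
  \<open>k\<close>, and no limit of the densities is taken. Only the means of the energy are
  controlled, and the entropy estimate asks for no more: its two means are the cases
  \<open>n = k\<close> and \<open>n = 0\<close> of one bound, since \<open>\<mu>k 0\<close> is
  \<open>\<mu>\<close>. Setwise limits keep topology out of the argument. They can be tested against
  any bounded measurable function, in particular against the kernels of \<open>Psi0 Phi\<close>, so
  no continuity of kernels is used. The price is that a subsequence chosen on cylinders must be
  shown to converge on the whole sigma-algebra, and this is where uniform absolute continuity with
  respect to \<open>\<mu>\<close> enters. Deleting terms can only lower the sums in Dobrushin's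
  condition, so one constant \<open>c\<close> serves \<open>Phi\<close>, every \<open>Phik\<close>
  and \<open>Psi0 Phi\<close>.\<close>

definition gibbs_avg :: "'a set \<Rightarrow> ('a \<Rightarrow> real) \<Rightarrow> ('a \<Rightarrow> real) \<Rightarrow> real" where
  "gibbs_avg S u h = (\<Sum>x\<in>S. h x * exp (- u x)) / (\<Sum>x\<in>S. exp (- u x))"

lemma gibbs_avg_partition_pos:
  fixes u :: "'a \<Rightarrow> real"
  assumes "finite S" "S \<noteq> {}"
  shows "(\<Sum>x\<in>S. exp (- u x)) > 0"
  using assms by (intro sum_pos) auto

lemma gibbs_avg_mono:
  assumes "finite S" "S \<noteq> {}" "\<And>x. x \<in> S \<Longrightarrow> h x \<le> g x"
  shows "gibbs_avg S u h \<le> gibbs_avg S u g"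
  unfolding gibbs_avg_def using gibbs_avg_partition_pos[OF assms(1,2), of u] assms(3)
  by (intro divide_right_mono sum_mono mult_right_mono) auto

lemma gibbs_avg_const:
  assumes "finite S" "S \<noteq> {}"
  shows "gibbs_avg S u (\<lambda>_. c) = c"
  unfolding gibbs_avg_def using gibbs_avg_partition_pos[OF assms, of u]
  by (simp flip: sum_distrib_left)

lemma gibbs_avg_diff: "gibbs_avg S u h - gibbs_avg S u g = gibbs_avg S u (\<lambda>x. h x - g x)"
  unfolding gibbs_avg_def by (simp add: left_diff_distrib sum_subtractf diff_divide_distrib)

lemma gibbs_avg_cmult: "gibbs_avg S u (\<lambda>x. c * h x) = c * gibbs_avg S u h"
  unfolding gibbs_avg_def by (simp add: sum_distrib_left mult.assoc)

lemma gibbs_avg_sum: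
  "gibbs_avg S u (\<lambda>x. \<Sum>i\<in>I. h i x) = (\<Sum>i\<in>I. gibbs_avg S u (h i))"
  unfolding gibbs_avg_def sum_divide_distrib[symmetric] sum_distrib_right
  by (subst sum.swap) simp

lemma gibbs_avg_abs_le:
  assumes "finite S" "S \<noteq> {}" "\<And>x. x \<in> S \<Longrightarrow> \<bar>h x\<bar> \<le> B"
  shows "\<bar>gibbs_avg S u h\<bar> \<le> B"
proof -
  have "gibbs_avg S u h \<le> gibbs_avg S u (\<lambda>_. B)"
    using assms(3) by (intro gibbs_avg_mono assms(1,2)) (fastforce simp: abs_le_iff)
  moreover have "gibbs_avg S u (\<lambda>_. - B) \<le> gibbs_avg S u h"
    using assms(3) by (intro gibbs_avg_mono assms(1,2)) (fastforce simp: abs_le_iff)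
  ultimately show ?thesis using gibbs_avg_const[OF assms(1,2)] by (simp add: abs_le_iff)
qed

lemma abs_gibbs_avg_le_avg_abs:
  assumes "finite S" "S \<noteq> {}"
  shows "\<bar>gibbs_avg S u h\<bar> \<le> gibbs_avg S u (\<lambda>x. \<bar>h x\<bar>)"
proof -
  have "gibbs_avg S u h \<le> gibbs_avg S u (\<lambda>x. \<bar>h x\<bar>)"
    using assms by (intro gibbs_avg_mono) auto
  moreover have "gibbs_avg S u (\<lambda>x. - 1 * h x) \<le> gibbs_avg S u (\<lambda>x. \<bar>h x\<bar>)"
    using assms by (intro gibbs_avg_mono) auto
  ultimately show ?thesis unfolding gibbs_avg_cmult by simp
qed

lemma gibbs_avg_add: "gibbs_avg S u (\<lambda>x. h x + g x) = gibbs_avg S u h + gibbs_avg S u g"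
  unfolding gibbs_avg_def by (simp add: distrib_right sum.distrib add_divide_distrib)

text \<open>Popoviciu's inequality: the mean \<open>m\<close> minimises the mean square deviation,
  so replacing it by the midpoint \<open>c\<close> of the range can only increase the average, and
  no value is further than \<open>a / 2\<close> from \<open>c\<close>.\<close>

lemma gibbs_variance_le:
  assumes fin: "finite S" "S \<noteq> {}" and osc: "\<And>x y. x \<in> S \<Longrightarrow> y \<in> S \<Longrightarrow> \<bar>h x - h y\<bar> \<le> a"
  shows "gibbs_avg S u (\<lambda>x. (h x - gibbs_avg S u h)^2) \<le> a^2 / 4"
proof -
  define m where "m = gibbs_avg S u h"
  define c where "c = (Min (h ` S) + Max (h ` S)) / 2"
  obtain p q where pq: "p \<in> S" "q \<in> S" "Min (h ` S) = h p" "Max (h ` S) = h q"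
    using Min_in[of "h ` S"] Max_in[of "h ` S"] fin by (auto simp del: Min_in Max_in)
  have c: "\<bar>h x - c\<bar> \<le> a / 2" if "x \<in> S" for x
  proof -
    have "h p \<le> h x" "h x \<le> h q" using that fin pq(3,4)[symmetric] by auto
    moreover have "\<bar>h q - h p\<bar> \<le> a" using osc pq by blast
    ultimately show ?thesis unfolding c_def pq by (simp add: abs_le_iff field_simps)
  qed
  have "(h x - m)^2 = (h x - c)^2 + ((2 * (c - m)) * h x + (m\<^sup>2 - c\<^sup>2))" for x
    by (simp add: power2_eq_square algebra_simps)
  then have "gibbs_avg S u (\<lambda>x. (h x - m)^2)
      = gibbs_avg S u (\<lambda>x. (h x - c)^2) + ((2 * (c - m)) * m + (m\<^sup>2 - c\<^sup>2))"
    by (simp only: gibbs_avg_add gibbs_avg_cmult gibbs_avg_const[OF fin] m_def)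
  also have "\<dots> = gibbs_avg S u (\<lambda>x. (h x - c)^2) - (c - m)^2"
    by (simp add: power2_eq_square algebra_simps)
  also have "\<dots> \<le> gibbs_avg S u (\<lambda>x. (h x - c)^2)" by simp
  also have "\<dots> \<le> gibbs_avg S u (\<lambda>_. (a/2)^2)"
    using power_mono[OF c, of _ 2] by (intro gibbs_avg_mono fin) auto
  finally show ?thesis by (simp add: gibbs_avg_const[OF fin] m_def power_divide)
qed

text \<open>The mean absolute deviation of \<open>h\<close> is at most its standard deviation, hence
  at most \<open>a / 2\<close>, and \<open>w\<close> contributes the factor \<open>s\<close>. Square
  roots are avoided by bounding the deviation pointwise by a quadratic, tuned so that a variance of
  \<open>a^2 / 4\<close> returns exactly \<open>a / 2\<close>.\<close>

lemma gibbs_covariance_le: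
  assumes fin: "finite S" "S \<noteq> {}" and osc: "\<And>x y. x \<in> S \<Longrightarrow> y \<in> S \<Longrightarrow> \<bar>h x - h y\<bar> \<le> a"
    and w: "\<And>x. x \<in> S \<Longrightarrow> \<bar>w x\<bar> \<le> s"
  shows "\<bar>gibbs_avg S u (\<lambda>x. w x * (h x - gibbs_avg S u h))\<bar> \<le> s * a / 2"
proof -
  define m where "m = gibbs_avg S u h"
  obtain x0 where x0: "x0 \<in> S" using fin by auto
  have s: "s \<ge> 0" using w[OF x0] by auto
  have a: "a \<ge> 0" using osc[OF x0 x0] by auto
  have "\<bar>gibbs_avg S u (\<lambda>x. w x * (h x - m))\<bar> \<le> gibbs_avg S u (\<lambda>x. \<bar>w x * (h x - m)\<bar>)"
    by (rule abs_gibbs_avg_le_avg_abs[OF fin])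
  also have "\<dots> \<le> s * a / 2"
  proof (cases "a = 0")
    \<comment> \<open>The quadratic used in the other case has the coefficient \<open>1 / a\<close>.
      Here \<open>h\<close> is constant and equals its mean.\<close>
    case True
    have "h x = h x0" if "x \<in> S" for x using osc[OF that x0] True by simp
    then have "gibbs_avg S u h = gibbs_avg S u (\<lambda>_. h x0)"
      unfolding gibbs_avg_def by simp
    then have "m = h x0" using gibbs_avg_const[OF fin] m_def by metis
    then have "gibbs_avg S u (\<lambda>x. \<bar>w x * (h x - m)\<bar>) \<le> gibbs_avg S u (\<lambda>x. 0)"
      using \<open>\<And>x. x \<in> S \<Longrightarrow> h x = h x0\<close> by (intro gibbs_avg_mono fin) simp
    then show ?thesis by (simp add: True gibbs_avg_const[OF fin])
  next
    case False
    with a have a: "a > 0" by simp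
    \<comment> \<open>AM-GM: \<open>\<bar>d\<bar> \<le> d\<^sup>2 / a + a / 4\<close>\<close>
    have am: "\<bar>d\<bar> \<le> (1 / a) * d^2 + a / 4" for d :: real
    proof -
      have "0 \<le> (\<bar>d\<bar> - a / 2)^2 / a" using a by simp
      also have "\<dots> = (1 / a) * d^2 + a / 4 - \<bar>d\<bar>" using a
        by (simp add: power2_eq_square field_simps)
      finally show ?thesis by simp
    qed
    have "gibbs_avg S u (\<lambda>x. \<bar>w x * (h x - m)\<bar>)
        \<le> gibbs_avg S u (\<lambda>x. s * ((1 / a) * (h x - m)^2 + a / 4))"
      unfolding abs_mult using s w am by (intro gibbs_avg_mono fin mult_mono) auto
    also have "\<dots> = s * ((1 / a) * gibbs_avg S u (\<lambda>x. (h x - m)^2) + a / 4)"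
      by (simp only: gibbs_avg_cmult gibbs_avg_add gibbs_avg_const[OF fin])
    also have "\<dots> \<le> s * ((1 / a) * (a^2 / 4) + a / 4)"
      using gibbs_variance_le[OF fin osc] s a m_def
      by (intro mult_left_mono add_right_mono) auto
    also have "\<dots> = s * a / 2" using a by (simp add: power2_eq_square field_simps)
    finally show ?thesis .
  qed
  finally show ?thesis unfolding m_def .
qed

text \<open>The factor \<open>1/2\<close> is what makes the constant in \<^const>\<open>dobrushin\<close> sharp enough: the
  derivative of the average along the segment from \<open>u\<close> to \<open>v\<close> is a covariance.\<close>
lemma gibbs_avg_perturb:
  assumes fin: "finite S" "S \<noteq> {}" and osc: "\<And>x y. x \<in> S \<Longrightarrow> y \<in> S \<Longrightarrow> \<bar>h x - h y\<bar> \<le> a"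
    and uv: "\<And>x. x \<in> S \<Longrightarrow> \<bar>u x - v x\<bar> \<le> s"
  shows "\<bar>gibbs_avg S u h - gibbs_avg S v h\<bar> \<le> s * a / 2"
proof -
  define w where "w x = u x - v x" for x
  define p where "p t x = u x - t * w x" for t x
  define \<phi> where "\<phi> t = gibbs_avg S (p t) h" for t
  define N where "N t = (\<Sum>x\<in>S. h x * exp (- p t x))" for t
  define Z where "Z t = (\<Sum>x\<in>S. exp (- p t x))" for t
  have Z: "Z t > 0" for t unfolding Z_def by (rule gibbs_avg_partition_pos[OF fin])
  have \<phi>: "\<phi> t = N t / Z t" for t unfolding \<phi>_def gibbs_avg_def N_def Z_def ..
  have der: "(\<phi> has_real_derivative gibbs_avg S (p t) (\<lambda>x. w x * (h x - \<phi> t))) (at t)" for t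
  proof -
    have N': "(N has_real_derivative (\<Sum>x\<in>S. w x * h x * exp (- p t x))) (at t)"
      unfolding N_def p_def by (rule derivative_eq_intros sum.cong refl | simp)+
    have Z': "(Z has_real_derivative (\<Sum>x\<in>S. w x * exp (- p t x))) (at t)"
      unfolding Z_def p_def by (rule derivative_eq_intros sum.cong refl | simp)+
    have "gibbs_avg S (p t) (\<lambda>x. w x * (h x - \<phi> t))
        = ((\<Sum>x\<in>S. w x * h x * exp (- p t x)) - \<phi> t * (\<Sum>x\<in>S. w x * exp (- p t x))) / Z t"
      unfolding gibbs_avg_def Z_def
      by (simp add: algebra_simps sum_subtractf sum_distrib_left)
    also have "\<dots> = ((\<Sum>x\<in>S. w x * h x * exp (- p t x)) * Z t
         - N t * (\<Sum>x\<in>S. w x * exp (- p t x))) / (Z t * Z t)"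
      unfolding \<phi> using Z[of t] by (simp add: field_simps)
    finally have eq: "gibbs_avg S (p t) (\<lambda>x. w x * (h x - \<phi> t)) = \<dots>" .
    show ?thesis unfolding eq using DERIV_divide[OF N' Z'] Z[of t] ext[of \<phi>, OF \<phi>] by simp
  qed
  obtain t where t: "\<phi> 1 - \<phi> 0 = gibbs_avg S (p t) (\<lambda>x. w x * (h x - \<phi> t))"
    using MVT2[of 0 1 \<phi> "\<lambda>t. gibbs_avg S (p t) (\<lambda>x. w x * (h x - \<phi> t))"] der by auto
  have "\<bar>\<phi> 1 - \<phi> 0\<bar> \<le> s * a / 2"
    unfolding t unfolding \<phi>_def by (rule gibbs_covariance_le[OF fin osc]) (auto simp: w_def uv)
  moreover have "p 0 = u" "p 1 = v" unfolding p_def w_def by auto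
  ultimately show ?thesis unfolding \<phi>_def by (simp add: abs_minus_commute)
qed

section \<open>Interactions and kernels\<close>

lemma space_Xsp [simp]: "space (Xsp :: (int \<Rightarrow> 'e::finite) measure) = UNIV"
  unfolding Xsp_def by (simp add: space_PiM PiE_def)

text \<open>\<open>Phi V\<close> factors through the restriction to \<open>V\<close>, and a finite
  alphabet leaves finitely many restrictions. The suprema in \<open>supnorm\<close> and
  \<open>osc\<close> thus range over bounded sets; without boundedness a real \<open>SUP\<close>
  need not be an upper bound.\<close>

lemma interaction_range_finite:
  fixes Phi :: "('e::finite) interaction"
  assumes "interaction Phi" "finite V"
  shows "finite (range (Phi V))"
proof (rule finite_subset)
  show "range (Phi V) \<subseteq> Phi V ` (V \<rightarrow>\<^sub>E UNIV)"
  proof safe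
    fix \<omega> :: "int \<Rightarrow> 'e"
    have "Phi V \<omega> = Phi V (restrict \<omega> V)" using assms unfolding interaction_def by auto
    then show "Phi V \<omega> \<in> Phi V ` (V \<rightarrow>\<^sub>E UNIV)" by auto
  qed
  show "finite (Phi V ` (V \<rightarrow>\<^sub>E UNIV))" using assms(2) by (intro finite_imageI finite_PiE) auto
qed

lemma interaction_abs_le_supnorm:
  fixes Phi :: "('e::finite) interaction"
  assumes "interaction Phi" "finite V"
  shows "\<bar>Phi V \<omega>\<bar> \<le> supnorm (Phi V)"
proof -
  have "finite (abs ` range (Phi V))"
    using interaction_range_finite[OF assms] by (rule finite_imageI)
  then have "bdd_above (range (\<lambda>\<omega>. \<bar>Phi V \<omega>\<bar>))" by (simp add: image_image)
  then show ?thesis unfolding supnorm_def by (rule cSUP_upper2) auto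
qed

lemma interaction_diff_le_osc:
  fixes Phi :: "('e::finite) interaction"
  assumes "interaction Phi" "finite V"
  shows "\<bar>Phi V \<omega> - Phi V \<eta>\<bar> \<le> osc (Phi V)"
proof -
  have "finite ((\<lambda>(x, y). \<bar>x - y\<bar>) ` (range (Phi V) \<times> range (Phi V)))"
    using interaction_range_finite[OF assms] by simp
  then have "finite (range (\<lambda>p. \<bar>Phi V (fst p) - Phi V (snd p)\<bar>))"
    by (rule rev_finite_subset) auto
  then have "bdd_above (range (\<lambda>p. \<bar>Phi V (fst p) - Phi V (snd p)\<bar>))" by simp
  from cSUP_upper[OF _ this, of "(\<omega>, \<eta>)"] show ?thesis unfolding osc_def by simp
qed

lemma interaction_supnorm_nonneg:
  assumes "interaction (Phi :: ('e::finite) interaction)" "finite V"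
  shows "0 \<le> supnorm (Phi V)"
  using interaction_abs_le_supnorm[OF assms] abs_ge_zero order_trans by blast

lemma interaction_osc_nonneg:
  assumes "interaction (Phi :: ('e::finite) interaction)" "finite V"
  shows "0 \<le> osc (Phi V)"
  using interaction_diff_le_osc[OF assms] abs_ge_zero order_trans by blast

lemma interaction_osc_le_supnorm:
  assumes "interaction (Phi :: ('e::finite) interaction)" "finite V"
  shows "osc (Phi V) \<le> 2 * supnorm (Phi V)"
  unfolding osc_def
proof (rule cSUP_least)
  fix p :: "(int \<Rightarrow> 'e) \<times> (int \<Rightarrow> 'e)"
  show "\<bar>Phi V (fst p) - Phi V (snd p)\<bar> \<le> 2 * supnorm (Phi V)"
    using interaction_abs_le_supnorm[OF assms, of "fst p"]
      interaction_abs_le_supnorm[OF assms, of "snd p"] by linarith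
qed simp

lemma interaction_measurable:
  assumes "interaction (Phi :: ('e::finite) interaction)" "finite V"
  shows "Phi V \<in> borel_measurable Xsp"
proof -
  have "(\<lambda>\<omega>. restrict \<omega> V) \<in> measurable Xsp (PiM V (\<lambda>_. count_space (UNIV::'e set)))"
    unfolding Xsp_def by (rule measurable_restrict_subset) auto
  also have "PiM V (\<lambda>_. count_space (UNIV::'e set)) = count_space (V \<rightarrow>\<^sub>E UNIV)"
    using assms(2) by (intro count_space_PiM_finite) auto
  finally have "(\<lambda>\<omega>. restrict \<omega> V) \<in> measurable Xsp (count_space (V \<rightarrow>\<^sub>E (UNIV::'e set)))" .
  from measurable_compose[OF this, of "Phi V" borel]
  have "(\<lambda>\<omega>. Phi V (restrict \<omega> V)) \<in> borel_measurable Xsp" by simp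
  also have "(\<lambda>\<omega>. Phi V (restrict \<omega> V)) = Phi V"
  proof
    fix \<omega> :: "int \<Rightarrow> 'e"
    show "Phi V (restrict \<omega> V) = Phi V \<omega>"
      using assms unfolding interaction_def by auto
  qed
  finally show ?thesis .
qed

text \<open>Enumerating the index set turns the unordered sum into a series, and a series of
  measurable functions is measurable.\<close>

lemma borel_measurable_infsum_real:
  fixes f :: "'a \<Rightarrow> 'b \<Rightarrow> real"
  assumes "countable A" and meas: "\<And>a. a \<in> A \<Longrightarrow> f a \<in> borel_measurable M"
    and sm: "\<And>x. (\<lambda>a. f a x) summable_on A"
  shows "(\<lambda>x. \<Sum>\<^sub>\<infinity>a\<in>A. f a x) \<in> borel_measurable M"
proof (cases "finite A")
  case True
  then show ?thesis using meas by simp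
next
  case False
  define e where "e = from_nat_into A"
  have e: "bij_betw e UNIV A"
    unfolding e_def using bij_betw_from_nat_into[OF assms(1) False] .
  have "(\<Sum>\<^sub>\<infinity>a\<in>A. f a x) = (\<Sum>n. f (e n) x)" for x
  proof -
    have "(\<lambda>n. f (e n) x) summable_on UNIV"
      using sm[of x] summable_on_reindex_bij_betw[OF e, of "\<lambda>a. f a x"] by simp
    then have "(\<lambda>n. f (e n) x) sums (\<Sum>\<^sub>\<infinity>n. f (e n) x)"
      by (intro has_sum_imp_sums has_sum_infsum)
    then show ?thesis using infsum_reindex_bij_betw[OF e, of "\<lambda>a. f a x"]
      by (simp add: sums_unique[symmetric])
  qed
  moreover have "e n \<in> A" for n using e by (auto simp: bij_betw_def)
  ultimately show ?thesis using meas by simp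
qed

lemma cupd_measurable: "cupd L \<sigma> \<in> measurable (Xsp :: (int \<Rightarrow> 'e::finite) measure) Xsp"
proof -
  have "(\<lambda>\<eta>. \<lambda>i. if i \<in> L then \<sigma> i else \<eta> i) \<in> measurable (Xsp :: (int \<Rightarrow> 'e) measure) Xsp"
    unfolding Xsp_def by (rule measurable_PiM_single') (auto simp: PiE_def)
  then show ?thesis by (simp add: cupd_def[abs_def])
qed

lemma cupd_cupd [simp]: "cupd L \<sigma> (cupd L \<tau> \<eta>) = cupd L \<sigma> \<eta>"
  unfolding cupd_def by auto

lemma finite_configs [simp]: "finite L \<Longrightarrow> finite (L \<rightarrow>\<^sub>E (UNIV :: 'e::finite set))"
  by (rule finite_PiE) auto

lemma configs_nonempty [simp]: "L \<rightarrow>\<^sub>E (UNIV :: 'e set) \<noteq> {}"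
  by (simp add: PiE_eq_empty_iff)

text \<open>\<open>gamma\<close> acts on sets only. Functions are needed because the uniqueness
  proof iterates kernels on Lipschitz functions, and the tilting argument averages
  \<open>g \<omega> * exp (energy K \<omega>)\<close>.\<close>

definition gibbs_kernel ::
    "'e::finite interaction \<Rightarrow> int set \<Rightarrow> ((int \<Rightarrow> 'e) \<Rightarrow> real) \<Rightarrow> (int \<Rightarrow> 'e) \<Rightarrow> real" where
  "gibbs_kernel Phi L f \<eta> = gibbs_avg (L \<rightarrow>\<^sub>E UNIV) (\<lambda>\<sigma>. hamiltonian Phi L (cupd L \<sigma> \<eta>))
     (\<lambda>\<sigma>. f (cupd L \<sigma> \<eta>))"

lemma gamma_eq_gibbs_kernel: "gamma Phi L A = gibbs_kernel Phi L (indicator A)"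
  unfolding gamma_def gibbs_kernel_def gibbs_avg_def by auto

lemma gibbs_kernel_diff_le:
  assumes "finite L" "\<And>\<omega>. \<bar>f \<omega> - g \<omega>\<bar> \<le> B"
  shows "\<bar>gibbs_kernel Phi L f \<eta> - gibbs_kernel Phi L g \<eta>\<bar> \<le> B"
  unfolding gibbs_kernel_def gibbs_avg_diff
  by (rule gibbs_avg_abs_le) (use assms in auto)

lemma gibbs_kernel_abs_le:
  assumes "finite L" "\<And>\<omega>. \<bar>f \<omega>\<bar> \<le> B"
  shows "\<bar>gibbs_kernel Phi L f \<eta>\<bar> \<le> B"
  unfolding gibbs_kernel_def by (rule gibbs_avg_abs_le) (use assms in auto)

section \<open>Summability and measurability under uniform absolute convergence\<close>

locale uac_interaction =
  fixes Phi :: "('e::finite) interaction"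
  assumes int: "interaction Phi" and uac: "UAC Phi"
begin

lemma supnorm_summable:
  assumes "finite L"
  shows "(\<lambda>V. supnorm (Phi V)) summable_on {V. finite V \<and> V \<inter> L \<noteq> {}}"
  using assms
proof (induction L rule: finite_induct)
  case (insert i L)
  have "{V. finite V \<and> V \<inter> insert i L \<noteq> {}}
      = {V. finite V \<and> i \<in> V} \<union> {V. finite V \<and> V \<inter> L \<noteq> {}}" by auto
  moreover have "(\<lambda>V. supnorm (Phi V)) summable_on {V. finite V \<and> i \<in> V}"
    using uac unfolding UAC_def by blast
  ultimately show ?case using insert.IH by (simp add: summable_on_union)
qed simp

lemma interaction_abs_summable:
  assumes "finite L"
  shows "(\<lambda>V. Phi V \<omega>) summable_on {V. finite V \<and> V \<inter> L \<noteq> {}}"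
proof -
  have "(\<lambda>V. norm (Phi V \<omega>)) summable_on {V. finite V \<and> V \<inter> L \<noteq> {}}"
    by (rule Infinite_Sum.abs_summable_on_comparison_test'[OF supnorm_summable[OF assms]])
      (auto intro: interaction_abs_le_supnorm int)
  then show ?thesis by (rule abs_summable_summable)
qed

lemma hamiltonian_measurable:
  assumes "finite L"
  shows "hamiltonian Phi L \<in> borel_measurable Xsp"
proof -
  have "countable {V. finite V \<and> V \<inter> L \<noteq> {}}"
    by (rule countable_subset[OF _ countable_Collect_finite]) auto
  then have "(\<lambda>\<omega>. hamiltonian Phi L \<omega>) \<in> borel_measurable Xsp"
    unfolding hamiltonian_def
    by (rule borel_measurable_infsum_real)
      (auto intro: interaction_measurable int interaction_abs_summable assms)
  then show ?thesis .
qed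

lemma gibbs_kernel_measurable:
  assumes "finite L" "f \<in> borel_measurable Xsp"
  shows "gibbs_kernel Phi L f \<in> borel_measurable Xsp"
proof -
  have [measurable]: "(\<lambda>\<eta>. f (cupd L \<sigma> \<eta>)) \<in> borel_measurable Xsp"
    "(\<lambda>\<eta>. hamiltonian Phi L (cupd L \<sigma> \<eta>)) \<in> borel_measurable Xsp" for \<sigma>
    by (rule measurable_compose[OF cupd_measurable assms(2)],
        rule measurable_compose[OF cupd_measurable hamiltonian_measurable[OF assms(1)]])
  show ?thesis unfolding gibbs_kernel_def[abs_def] gibbs_avg_def by measurable
qed

end

section \<open>Step functions and the Gibbs equation for bounded functions\<close>

lemma borel_measurable_step_approx:
  fixes f :: "'a \<Rightarrow> real"
  assumes f: "f \<in> borel_measurable M" and B: "\<And>x. x \<in> space M \<Longrightarrow> \<bar>f x\<bar> \<le> B" and "\<epsilon> > 0"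
  obtains I :: "int set" and c A where "finite I" "\<And>m. A m \<in> sets M"
    "\<And>x. x \<in> space M \<Longrightarrow> \<bar>f x - (\<Sum>m\<in>I. c m * indicator (A m) x)\<bar> \<le> \<epsilon>"
proof -
  \<comment> \<open>\<open>A m\<close> collects the points where \<open>f / \<epsilon>\<close>
    rounds down to \<open>m\<close>. The error is at most \<open>\<epsilon>\<close> at every point,
    so averaging by any kernel or probability measure does not enlarge it.\<close>
  define A where "A m = {x \<in> space M. \<lfloor>f x / \<epsilon>\<rfloor> = m}" for m
  define N where "N = \<lceil>B / \<epsilon>\<rceil> + 1"
  have "A m \<in> sets M" for m
  proof -
    have "A m = {x \<in> space M. of_int m \<le> f x / \<epsilon> \<and> f x / \<epsilon> < of_int m + 1}"
      unfolding A_def by (auto simp: floor_eq_iff)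
    also have "\<dots> \<in> sets M" using f by measurable
    finally show ?thesis .
  qed
  moreover have "\<bar>f x - (\<Sum>m\<in>{-N..N}. (\<epsilon> * of_int m) * indicator (A m) x)\<bar> \<le> \<epsilon>"
    if x: "x \<in> space M" for x
  proof -
    define n where "n = \<lfloor>f x / \<epsilon>\<rfloor>"
    have "f x / \<epsilon> \<le> B / \<epsilon>" "- (B / \<epsilon>) \<le> f x / \<epsilon>"
      using B[OF x] \<open>\<epsilon> > 0\<close> by (simp_all add: field_simps abs_le_iff)
    then have n: "n \<in> {-N..N}" unfolding n_def N_def by (simp, linarith)
    have "(\<Sum>m\<in>{-N..N}. (\<epsilon> * of_int m) * indicator (A m) x)
        = (\<Sum>m\<in>{-N..N}. if m = n then \<epsilon> * of_int m else 0)"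
      by (intro sum.cong) (auto simp: A_def n_def x)
    also have "\<dots> = \<epsilon> * of_int n" using n by simp
    finally have eq: "(\<Sum>m\<in>{-N..N}. (\<epsilon> * of_int m) * indicator (A m) x) = \<epsilon> * of_int n" .
    have "f x = \<epsilon> * (f x / \<epsilon>)" using \<open>\<epsilon> > 0\<close> by simp
    then have "f x - \<epsilon> * of_int n = \<epsilon> * (f x / \<epsilon> - of_int n)" by (simp add: algebra_simps)
    moreover have "0 \<le> f x / \<epsilon> - of_int n" "f x / \<epsilon> - of_int n \<le> 1"
      unfolding n_def by linarith+
    ultimately show ?thesis unfolding eq using \<open>\<epsilon> > 0\<close>
      by (simp add: abs_mult mult_left_le)
  qed
  ultimately show thesis by (intro that[of "{-N..N}" A "\<lambda>m. \<epsilon> * of_int m"]) auto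
qed

lemma (in finite_measure) integrable_bounded_real:
  fixes f :: "'a \<Rightarrow> real"
  assumes "f \<in> borel_measurable M" "\<And>x. x \<in> space M \<Longrightarrow> \<bar>f x\<bar> \<le> B"
  shows "integrable M f"
  using assms by (intro integrable_const_bound[where B=B]) auto

lemma (in prob_space) integral_abs_le:
  fixes f :: "'a \<Rightarrow> real"
  assumes "\<And>x. x \<in> space M \<Longrightarrow> \<bar>f x\<bar> \<le> B"
  shows "\<bar>\<integral>x. f x \<partial>M\<bar> \<le> B"
proof (cases "integrable M f")
  case True
  have "\<bar>\<integral>x. f x \<partial>M\<bar> \<le> (\<integral>x. \<bar>f x\<bar> \<partial>M)" by (rule integral_abs_bound)
  also have "\<dots> \<le> (\<integral>x. B \<partial>M)" using True assms by (intro integral_mono) auto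
  finally show ?thesis by (simp add: prob_space)
next
  \<comment> \<open>The integral of a non-integrable function is 0 by default, and \<open>B\<close>
    is nonnegative because a probability space has a point.\<close>
  case False
  obtain x where "x \<in> space M" using not_empty by auto
  then have "B \<ge> 0" using assms[of x] by linarith
  with False show ?thesis by (simp add: not_integrable_integral_eq)
qed

lemma (in prob_space) integral_diff_abs_le:
  fixes f :: "'a \<Rightarrow> real"
  assumes "integrable M f" "integrable M g" "\<And>x. x \<in> space M \<Longrightarrow> \<bar>f x - g x\<bar> \<le> \<epsilon>"
  shows "\<bar>(\<integral>x. f x \<partial>M) - (\<integral>x. g x \<partial>M)\<bar> \<le> \<epsilon>"
  using integral_abs_le[of "\<lambda>x. f x - g x" \<epsilon>] assms by simp

lemma (in prob_space) integral_step:
  assumes "finite I" "\<And>m. m \<in> I \<Longrightarrow> A m \<in> sets M"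
  shows "(\<integral>x. (\<Sum>m\<in>I. c m * indicator (A m) x) \<partial>M) = (\<Sum>m\<in>I. c m * prob (A m))"
proof -
  have "integrable M (\<lambda>x. c m * indicator (A m) x)" if "m \<in> I" for m
    using assms(2)[OF that] by (intro integrable_mult_right integrable_real_indicator) (auto simp: less_top[symmetric])
  then have "(\<integral>x. (\<Sum>m\<in>I. c m * indicator (A m) x) \<partial>M)
      = (\<Sum>m\<in>I. \<integral>x. c m * indicator (A m) x \<partial>M)" by (rule Bochner_Integration.integral_sum)
  also have "\<dots> = (\<Sum>m\<in>I. c m * prob (A m))"
    using assms(2) by (intro sum.cong) (auto simp: sets.Int_space_eq2)
  finally show ?thesis .
qed

lemma gibbs_prob_space: "gibbs Phi \<mu> \<Longrightarrow> prob_space \<mu>"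
  unfolding gibbs_def by blast

lemma gibbs_sets: "gibbs Phi \<mu> \<Longrightarrow> sets \<mu> = sets Xsp"
  unfolding gibbs_def by blast

lemma gibbs_gamma:
  "gibbs Phi \<mu> \<Longrightarrow> finite L \<Longrightarrow> A \<in> sets Xsp \<Longrightarrow> (\<integral>\<eta>. gamma Phi L A \<eta> \<partial>\<mu>) = measure \<mu> A"
  unfolding gibbs_def by metis

lemma gibbs_space: "gibbs Phi \<mu> \<Longrightarrow> space \<mu> = UNIV"
  by (simp add: sets_eq_imp_space_eq[OF gibbs_sets])

lemma gibbs_borel_measurable: "gibbs Phi \<mu> \<Longrightarrow> borel_measurable \<mu> = borel_measurable Xsp"
  using gibbs_sets by (auto intro!: measurable_cong_sets)

text \<open>\<open>gibbs\<close> states this for indicators only. Step functions follow by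
  linearity, and \<open>f\<close> is uniformly close to one; both sides then move by at most
  \<open>\<epsilon>\<close>, because kernels and probability integrals are averages.\<close>

lemma (in uac_interaction) gibbs_integral_kernel:
  assumes g: "gibbs Phi \<mu>" and L: "finite L"
    and f: "f \<in> borel_measurable Xsp" and B: "\<And>\<omega>. \<bar>f \<omega>\<bar> \<le> B"
  shows "(\<integral>\<omega>. gibbs_kernel Phi L f \<omega> \<partial>\<mu>) = (\<integral>\<omega>. f \<omega> \<partial>\<mu>)"
proof -
  interpret prob_space \<mu> using gibbs_prob_space[OF g] .
  note meas = gibbs_borel_measurable[OF g]
  note ker = gibbs_kernel_measurable[OF L]
  have "\<bar>(\<integral>\<omega>. gibbs_kernel Phi L f \<omega> \<partial>\<mu>) - (\<integral>\<omega>. f \<omega> \<partial>\<mu>)\<bar> \<le> 2 * \<epsilon>" if "\<epsilon> > 0" for \<epsilon>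
  proof -
    obtain I c A where I: "finite (I::int set)" and A: "\<And>m. A m \<in> sets Xsp"
      and ap: "\<And>x. \<bar>f x - (\<Sum>m\<in>I. c m * indicator (A m) x)\<bar> \<le> \<epsilon>"
      by (rule borel_measurable_step_approx[OF f _ \<open>\<epsilon> > 0\<close>, of B]) (auto intro: B)
    define s where "s x = (\<Sum>m\<in>I. c m * indicator (A m) x)" for x
    have A': "A m \<in> sets \<mu>" for m using A gibbs_sets[OF g] by simp
    have s[measurable]: "s \<in> borel_measurable Xsp" unfolding s_def[abs_def] using A by measurable
    have sB: "\<bar>s x\<bar> \<le> B + \<epsilon>" for x using ap[of x] B[of x] unfolding s_def by linarith
    have ii: "integrable \<mu> h" if "h \<in> borel_measurable Xsp" "\<And>x. \<bar>h x\<bar> \<le> C"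
      for h :: "_ \<Rightarrow> real" and C
      by (rule integrable_bounded_real[of h C]) (use that in \<open>simp_all only: meas\<close>)
    have "(\<integral>\<omega>. gibbs_kernel Phi L s \<omega> \<partial>\<mu>) = (\<integral>\<omega>. s \<omega> \<partial>\<mu>)"
    proof -
      have ks: "gibbs_kernel Phi L s \<omega> = (\<Sum>m\<in>I. c m * gamma Phi L (A m) \<omega>)" for \<omega>
        unfolding gamma_eq_gibbs_kernel gibbs_kernel_def s_def
        by (simp add: gibbs_avg_sum gibbs_avg_cmult)
      have int: "integrable \<mu> (gamma Phi L (A m))" for m
        unfolding gamma_eq_gibbs_kernel
        by (rule ii[OF ker gibbs_kernel_abs_le[OF L, where B=1]]) (use A in \<open>auto simp: indicator_def intro!: borel_measurable_indicator\<close>)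
      have "(\<integral>\<omega>. gibbs_kernel Phi L s \<omega> \<partial>\<mu>) = (\<Sum>m\<in>I. c m * (\<integral>\<omega>. gamma Phi L (A m) \<omega> \<partial>\<mu>))"
        unfolding ks using int by simp
      also have "\<dots> = (\<Sum>m\<in>I. c m * prob (A m))" by (simp only: gibbs_gamma[OF g L A])
      also have "\<dots> = (\<integral>\<omega>. s \<omega> \<partial>\<mu>)" unfolding s_def using integral_step[OF I A'] by simp
      finally show ?thesis .
    qed
    moreover have "\<bar>(\<integral>\<omega>. f \<omega> \<partial>\<mu>) - (\<integral>\<omega>. s \<omega> \<partial>\<mu>)\<bar> \<le> \<epsilon>"
      by (rule integral_diff_abs_le) (use ii[OF f B] ii[OF s sB] ap s_def in auto)
    moreover have "\<bar>(\<integral>\<omega>. gibbs_kernel Phi L f \<omega> \<partial>\<mu>) - (\<integral>\<omega>. gibbs_kernel Phi L s \<omega> \<partial>\<mu>)\<bar> \<le> \<epsilon>"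
    proof (rule integral_diff_abs_le)
      show "integrable \<mu> (gibbs_kernel Phi L f)" "integrable \<mu> (gibbs_kernel Phi L s)"
        by (rule ii[OF ker[OF f] gibbs_kernel_abs_le[OF L B]],
            rule ii[OF ker[OF s] gibbs_kernel_abs_le[OF L sB]])
      show "\<bar>gibbs_kernel Phi L f x - gibbs_kernel Phi L s x\<bar> \<le> \<epsilon>" for x
        by (rule gibbs_kernel_diff_le[OF L]) (use ap s_def in auto)
    qed
    ultimately show ?thesis by linarith
  qed
  \<comment> \<open>With \<open>\<epsilon>\<close> a quarter of the gap, the estimate bounds the gap
    by half of itself.\<close>
  from this[of "\<bar>(\<integral>\<omega>. gibbs_kernel Phi L f \<omega> \<partial>\<mu>) - (\<integral>\<omega>. f \<omega> \<partial>\<mu>)\<bar> / 4"]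
  show ?thesis by (cases "(\<integral>\<omega>. gibbs_kernel Phi L f \<omega> \<partial>\<mu>) = (\<integral>\<omega>. f \<omega> \<partial>\<mu>)") auto
qed

section \<open>Dobrushin's uniqueness theorem\<close>

lemma infsum_real_finite_sum:
  fixes f :: "'i \<Rightarrow> 'a \<Rightarrow> real"
  assumes "finite J" "\<And>j. j \<in> J \<Longrightarrow> f j summable_on A"
  shows "(\<lambda>x. \<Sum>j\<in>J. f j x) summable_on A" (is "?S J")
    and "(\<Sum>\<^sub>\<infinity>x\<in>A. \<Sum>j\<in>J. f j x) = (\<Sum>j\<in>J. infsum (f j) A)" (is "?E J")
proof -
  have "?S J \<and> ?E J" using assms
    by (induction J rule: finite_induct) (auto intro: summable_on_add simp: infsum_add)
  then show "?S J" "?E J" by auto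
qed

lemma infsum_real_indicator:
  fixes f :: "'a \<Rightarrow> real"
  assumes "f summable_on A"
  shows "(\<lambda>x. if P x then f x else 0) summable_on A"
    and "(\<Sum>\<^sub>\<infinity>x\<in>A. if P x then f x else 0) = infsum f {x\<in>A. P x}"
proof -
  have "f summable_on {x\<in>A. P x}"
    using assms by (rule summable_on_subset_banach) auto
  then show "(\<lambda>x. if P x then f x else 0) summable_on A"
    by (subst summable_on_cong_neutral[where T="{x\<in>A. P x}" and g=f]) auto
  show "(\<Sum>\<^sub>\<infinity>x\<in>A. if P x then f x else 0) = infsum f {x\<in>A. P x}"
    by (rule infsum_cong_neutral) auto
qed

text \<open>The bound \<open>c\<close> is a parameter instead of an existential witness, so that the
  same value can be passed on to interactions with terms removed.\<close>

locale dobrushin_interaction = uac_interaction Phi for Phi :: "('e::finite) interaction" +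
  fixes c :: real
  assumes c_less: "c < 1"
    and dob_summable: "\<And>i. (\<lambda>L. (real (card L) - 1) * osc (Phi L)) summable_on {L. finite L \<and> i \<in> L}"
    and dob_le: "\<And>i. (1/2) * (\<Sum>\<^sub>\<infinity>L\<in>{L. finite L \<and> i \<in> L}. (real (card L) - 1) * osc (Phi L)) \<le> c"
begin

text \<open>An upper bound for Dobrushin's interdependence matrix: how far, in total variation, the
  conditional law at \<open>i\<close> can move when only the spin at \<open>j\<close> changes. The
  diagonal is 0 because this law does not see the spin at \<open>i\<close>.\<close>

definition dep :: "int \<Rightarrow> int \<Rightarrow> real" where
  "dep i j = (if j = i then 0 else (1/2) * (\<Sum>\<^sub>\<infinity>V\<in>{V. finite V \<and> i \<in> V \<and> j \<in> V}. osc (Phi V)))"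

lemma osc_summable: "(\<lambda>V. osc (Phi V)) summable_on {V. finite V \<and> i \<in> V}"
proof (rule summable_on_comparison_test)
  have "(\<lambda>V. supnorm (Phi V)) summable_on {V. finite V \<and> i \<in> V}"
    using uac unfolding UAC_def by blast
  then show "(\<lambda>V. 2 * supnorm (Phi V)) summable_on {V. finite V \<and> i \<in> V}"
    by (rule summable_on_cmult_right)
qed (auto intro: interaction_osc_le_supnorm interaction_osc_nonneg int)

lemma osc_summable2: "(\<lambda>V. osc (Phi V)) summable_on {V. finite V \<and> i \<in> V \<and> j \<in> V}"
  by (rule summable_on_subset_banach[OF osc_summable[of i]]) auto

lemma dep_nonneg: "0 \<le> dep i j"
  unfolding dep_def by (auto intro!: infsum_nonneg interaction_osc_nonneg int)

text \<open>Exchanging the two sums counts each \<open>V\<close> containing \<open>i\<close> once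
  for every other site of \<open>V\<close> in \<open>J\<close>, so at most \<open>card V - 1\<close>
  times. This is the weight in Dobrushin's condition.\<close>

lemma sum_dep_le:
  assumes J: "finite J"
  shows "(\<Sum>j\<in>J. dep i j) \<le> c"
proof -
  let ?A = "{V. finite V \<and> i \<in> V}"
  let ?J = "J - {i}"
  have eq: "(\<Sum>\<^sub>\<infinity>V\<in>{V. finite V \<and> i \<in> V \<and> j \<in> V}. osc (Phi V))
      = (\<Sum>\<^sub>\<infinity>V\<in>?A. if j \<in> V then osc (Phi V) else 0)" for j
    using infsum_real_indicator(2)[OF osc_summable[of i], of "\<lambda>V. j \<in> V"] by simp
  have "(\<Sum>j\<in>J. dep i j) = (\<Sum>j\<in>?J. dep i j)"
    using J by (intro sum.mono_neutral_right) (auto simp: dep_def)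
  also have "\<dots> = (1/2) * (\<Sum>j\<in>?J. \<Sum>\<^sub>\<infinity>V\<in>?A. if j \<in> V then osc (Phi V) else 0)"
    unfolding sum_distrib_left by (intro sum.cong) (auto simp: dep_def eq)
  also have "(\<Sum>j\<in>?J. \<Sum>\<^sub>\<infinity>V\<in>?A. if j \<in> V then osc (Phi V) else 0)
      = (\<Sum>\<^sub>\<infinity>V\<in>?A. \<Sum>j\<in>?J. if j \<in> V then osc (Phi V) else 0)"
    using J by (intro infsum_real_finite_sum(2)[symmetric] infsum_real_indicator(1) osc_summable) auto
  also have "\<dots> \<le> (\<Sum>\<^sub>\<infinity>V\<in>?A. (real (card V) - 1) * osc (Phi V))"
  proof (rule infsum_mono)
    show "(\<lambda>V. \<Sum>j\<in>?J. if j \<in> V then osc (Phi V) else 0) summable_on ?A"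
      using J by (intro infsum_real_finite_sum(1) infsum_real_indicator(1) osc_summable) auto
    show "(\<lambda>V. (real (card V) - 1) * osc (Phi V)) summable_on ?A" by (rule dob_summable)
    fix V assume V: "V \<in> ?A"
    have "(\<Sum>j\<in>?J. if j \<in> V then osc (Phi V) else 0) = real (card (?J \<inter> V)) * osc (Phi V)"
      using J by (simp add: sum.inter_restrict[symmetric])
    also have "card (?J \<inter> V) \<le> card (V - {i})" using V by (intro card_mono) auto
    then have "real (card (?J \<inter> V)) \<le> real (card V) - 1"
      using V card_gt_0_iff[of V] by (auto simp: card_Diff_singleton of_nat_diff)
    then have "real (card (?J \<inter> V)) * osc (Phi V) \<le> (real (card V) - 1) * osc (Phi V)"
      using V by (intro mult_right_mono interaction_osc_nonneg int) auto
    finally show "(\<Sum>j\<in>?J. if j \<in> V then osc (Phi V) else 0) \<le> (real (card V) - 1) * osc (Phi V)" .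
  qed
  finally show ?thesis using dob_le[of i] by linarith
qed

lemma dep_summable: "dep i summable_on A"
  using sum_dep_le[of _ i] by (intro nonneg_bdd_above_summable_on dep_nonneg bdd_aboveI[of _ c]) auto

lemma infsum_dep_le: "infsum (dep i) A \<le> c"
  by (rule infsum_le_finite_sums[OF dep_summable]) (rule sum_dep_le)

lemma c_nonneg: "0 \<le> c"
  using sum_dep_le[of "{}"] by simp

lemma hamiltonian_diff_le:
  assumes eq: "\<xi> i = \<eta> i"
  shows "\<bar>hamiltonian Phi {i} \<xi> - hamiltonian Phi {i} \<eta>\<bar> \<le> 2 * infsum (dep i) {j. \<xi> j \<noteq> \<eta> j}"
proof -
  let ?A = "{V. finite V \<and> i \<in> V}"
  let ?D = "{j. \<xi> j \<noteq> \<eta> j}"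
  let ?d = "\<lambda>V. Phi V \<xi> - Phi V \<eta>"
  have A: "{V. finite V \<and> V \<inter> {i} \<noteq> {}} = ?A" by auto
  have s: "(\<lambda>V. Phi V \<omega>) summable_on ?A" for \<omega>
    using interaction_abs_summable[of "{i}" \<omega>] unfolding A by simp
  have "(\<lambda>V. norm (?d V)) summable_on ?A"
    by (rule Infinite_Sum.abs_summable_on_comparison_test'[OF osc_summable])
      (auto intro: interaction_diff_le_osc int)
  then have "\<bar>infsum ?d ?A\<bar> \<le> (\<Sum>\<^sub>\<infinity>V\<in>?A. norm (?d V))"
    using norm_infsum_bound by fastforce
  also have "\<dots> \<le> 2 * infsum (dep i) ?D"
  proof (rule infsum_le_finite_sums)
    fix F assume F: "finite F" "F \<subseteq> ?A"
    \<comment> \<open>\<open>?D\<close> may be infinite, but only finitely many of its sites lie in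
      a set of \<open>F\<close>. A term whose set misses \<open>?D\<close> does not change; any
      other term is charged to every site of \<open>J\<close> in its set, which can only
      overcount.\<close>
    define J where "J = \<Union>F \<inter> ?D"
    have J: "finite J" unfolding J_def using F by auto
    have "(\<Sum>V\<in>F. norm (?d V)) \<le> (\<Sum>V\<in>F. \<Sum>j\<in>J. if j \<in> V then osc (Phi V) else 0)"
    proof (rule sum_mono)
      fix V assume V: "V \<in> F"
      then have fin: "finite V" using F by auto
      have nn: "0 \<le> osc (Phi V)" using fin int interaction_osc_nonneg by blast
      show "norm (?d V) \<le> (\<Sum>j\<in>J. if j \<in> V then osc (Phi V) else 0)"
      proof (cases "V \<inter> ?D = {}")
        case True
        then have "Phi V \<xi> = Phi V \<eta>" using int fin unfolding interaction_def by blast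
        then show ?thesis using nn by (simp add: sum_nonneg)
      next
        case False
        then obtain j where j: "j \<in> V" "j \<in> J" unfolding J_def using V by auto
        have "norm (?d V) \<le> (if j \<in> V then osc (Phi V) else 0)"
          using j interaction_diff_le_osc[OF int fin] by simp
        also have "\<dots> \<le> (\<Sum>j\<in>J. if j \<in> V then osc (Phi V) else 0)"
          by (rule member_le_sum[OF j(2)]) (use nn J in auto)
        finally show ?thesis .
      qed
    qed
    also have "\<dots> = (\<Sum>j\<in>J. \<Sum>V\<in>{V\<in>F. j \<in> V}. osc (Phi V))"
      using F by (subst sum.swap) (simp add: sum.inter_filter)
    also have "\<dots> \<le> (\<Sum>j\<in>J. 2 * dep i j)"
    proof (rule sum_mono)
      fix j assume "j \<in> J"
      then have ji: "j \<noteq> i" using eq unfolding J_def by auto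
      have "(\<Sum>V\<in>{V\<in>F. j \<in> V}. osc (Phi V))
          \<le> (\<Sum>\<^sub>\<infinity>V\<in>{V. finite V \<and> i \<in> V \<and> j \<in> V}. osc (Phi V))"
        using F by (intro finite_sum_le_infsum osc_summable2) (auto intro: interaction_osc_nonneg int)
      then show "(\<Sum>V\<in>{V\<in>F. j \<in> V}. osc (Phi V)) \<le> 2 * dep i j" using ji by (simp add: dep_def)
    qed
    also have "\<dots> \<le> 2 * infsum (dep i) ?D" unfolding sum_distrib_left[symmetric]
      using J unfolding J_def
      by (intro mult_left_mono finite_sum_le_infsum dep_summable dep_nonneg) auto
    finally show "(\<Sum>V\<in>F. norm (?d V)) \<le> 2 * infsum (dep i) ?D" .
  qed fact
  also have "infsum ?d ?A = hamiltonian Phi {i} \<xi> - hamiltonian Phi {i} \<eta>"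
    unfolding hamiltonian_def A
    using infsum_add[OF s[of \<xi>] summable_on_uminus[THEN iffD2, OF s[of \<eta>]]]
    by (simp add: infsum_uminus)
  finally show ?thesis .
qed

end

text \<open>Lipschitz continuity for a weighted Hamming distance. It refers to the whole
  disagreement set, since oscillations at single sites would not suffice: a function of the tail has
  none, yet need not be constant.\<close>

definition hamming_lipschitz :: "(int \<Rightarrow> real) \<Rightarrow> ((int \<Rightarrow> 'e::finite) \<Rightarrow> real) \<Rightarrow> bool" where
  "hamming_lipschitz a f \<longleftrightarrow> (\<forall>j. 0 \<le> a j) \<and> a summable_on UNIV \<and> f \<in> borel_measurable Xsp \<and>
     (\<forall>\<xi> \<eta>. \<bar>f \<xi> - f \<eta>\<bar> \<le> infsum a {j. \<xi> j \<noteq> \<eta> j})"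

lemma hamming_lipschitz_bounded:
  assumes "hamming_lipschitz a f"
  shows "\<bar>f \<xi> - f \<eta>\<bar> \<le> infsum a UNIV" "\<bar>f \<xi>\<bar> \<le> \<bar>f \<eta>\<bar> + infsum a UNIV"
proof -
  have a: "a summable_on UNIV" "\<And>j. 0 \<le> a j" using assms unfolding hamming_lipschitz_def by auto
  have "\<bar>f \<xi> - f \<eta>\<bar> \<le> infsum a {j. \<xi> j \<noteq> \<eta> j}"
    using assms unfolding hamming_lipschitz_def by auto
  also have "\<dots> \<le> infsum a UNIV"
    by (rule infsum_mono2) (auto intro: a summable_on_subset_banach[OF a(1)])
  finally show 1: "\<bar>f \<xi> - f \<eta>\<bar> \<le> infsum a UNIV" .
  then show "\<bar>f \<xi>\<bar> \<le> \<bar>f \<eta>\<bar> + infsum a UNIV" by linarith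
qed

section \<open>Contraction of the weights by resampling single sites\<close>

context dobrushin_interaction
begin

definition dep_update :: "int \<Rightarrow> (int \<Rightarrow> real) \<Rightarrow> int \<Rightarrow> real" where
  "dep_update i a j = (if j = i then 0 else a j) + a i * dep i j"

lemma dep_update_summable:
  assumes "a summable_on UNIV"
  shows "dep_update i a summable_on A"
proof -
  have "a summable_on A" using assms by (rule summable_on_subset_banach) auto
  then have "(\<lambda>j. if j \<noteq> i then a j else 0) summable_on A" by (rule infsum_real_indicator(1))
  moreover have "(\<lambda>j. if j \<noteq> i then a j else 0) = (\<lambda>j. if j = i then 0 else a j)" by auto
  ultimately show ?thesis unfolding dep_update_def[abs_def]
    by (intro summable_on_add summable_on_cmult_right dep_summable) auto
qed

lemma infsum_dep_update:
  assumes "a summable_on UNIV"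
  shows "infsum (dep_update i a) A = infsum a (A - {i}) + a i * infsum (dep i) A"
proof -
  have s: "a summable_on A" using assms by (rule summable_on_subset_banach) auto
  have "(\<lambda>j. if j \<noteq> i then a j else 0) = (\<lambda>j. if j = i then 0 else a j)" by auto
  moreover have "{j\<in>A. j \<noteq> i} = A - {i}" by auto
  ultimately have "(\<lambda>j. if j = i then 0 else a j) summable_on A"
      "(\<Sum>\<^sub>\<infinity>j\<in>A. if j = i then 0 else a j) = infsum a (A - {i})"
    using infsum_real_indicator[OF s, of "\<lambda>j. j \<noteq> i"] by simp_all
  then show ?thesis unfolding dep_update_def
    by (subst infsum_add) (auto intro: summable_on_cmult_right dep_summable simp: infsum_cmult_right')
qed

lemma infsum_dep_update_le:
  assumes "a summable_on UNIV" "0 \<le> a i"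
  shows "infsum (dep_update i a) UNIV \<le> infsum a UNIV - (1 - c) * a i"
proof -
  have sm: "a summable_on (UNIV - {i})" by (rule summable_on_subset_banach[OF assms(1)]) simp
  have "infsum a UNIV = infsum a (insert i (UNIV - {i}))" by (simp only: insert_Diff_single insert_UNIV)
  also have "\<dots> = a i + infsum a (UNIV - {i})" by (rule infsum_insert[OF sm]) simp
  finally have "infsum a (UNIV - {i}) = infsum a UNIV - a i" by simp
  moreover have "a i * infsum (dep i) UNIV \<le> a i * c"
    using assms(2) by (intro mult_left_mono infsum_dep_le)
  ultimately show ?thesis unfolding infsum_dep_update[OF assms(1)] by (simp add: algebra_simps)
qed

text \<open>The passage from \<open>\<xi>\<close> to \<open>\<eta>\<close> takes two moves. With the
  Gibbs weights fixed, both configurations receive the same spin at \<open>i\<close>, so that site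
  leaves the disagreement set. With the test function fixed, its oscillation in the new spin is at
  most \<open>a i\<close>; the 2 from the Hamiltonian estimate and the 1/2 from
  \<open>gibbs_avg_perturb\<close> cancel.\<close>

lemma gibbs_kernel_hamming_lipschitz:
  assumes f: "hamming_lipschitz a f"
  shows "hamming_lipschitz (dep_update i a) (gibbs_kernel Phi {i} f)"
proof -
  have a: "a summable_on UNIV" "\<And>j. 0 \<le> a j" and meas: "f \<in> borel_measurable Xsp"
    and lip: "\<And>\<xi> \<eta>. \<bar>f \<xi> - f \<eta>\<bar> \<le> infsum a {j. \<xi> j \<noteq> \<eta> j}"
    using f unfolding hamming_lipschitz_def by auto
  have aA: "a summable_on A" for A by (rule summable_on_subset_banach[OF a(1)]) auto
  have "\<bar>gibbs_kernel Phi {i} f \<xi> - gibbs_kernel Phi {i} f \<eta>\<bar>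
      \<le> infsum (dep_update i a) {j. \<xi> j \<noteq> \<eta> j}" for \<xi> \<eta>
  proof -
    let ?D = "{j. \<xi> j \<noteq> \<eta> j}"
    let ?S = "{i} \<rightarrow>\<^sub>E (UNIV :: 'e set)"
    let ?u = "\<lambda>\<xi> \<sigma>. hamiltonian Phi {i} (cupd {i} \<sigma> \<xi>)"
    let ?h = "\<lambda>\<xi> \<sigma>. f (cupd {i} \<sigma> \<xi>)"
    have fin: "finite ?S" "?S \<noteq> {}" using finite_configs[of "{i}"] configs_nonempty[of "{i}"] by blast+
    have D: "{j. cupd {i} \<sigma> \<xi> j \<noteq> cupd {i} \<sigma> \<eta> j} = ?D - {i}" for \<sigma>
      unfolding cupd_def by auto
    have "\<bar>gibbs_avg ?S (?u \<xi>) (?h \<xi>) - gibbs_avg ?S (?u \<xi>) (?h \<eta>)\<bar> \<le> infsum a (?D - {i})"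
      unfolding gibbs_avg_diff
    proof (rule gibbs_avg_abs_le[OF fin])
      fix \<sigma> :: "int \<Rightarrow> 'e"
      show "\<bar>?h \<xi> \<sigma> - ?h \<eta> \<sigma>\<bar> \<le> infsum a (?D - {i})"
        using lip[of "cupd {i} \<sigma> \<xi>" "cupd {i} \<sigma> \<eta>"] unfolding D .
    qed
    moreover have "\<bar>gibbs_avg ?S (?u \<xi>) (?h \<eta>) - gibbs_avg ?S (?u \<eta>) (?h \<eta>)\<bar>
        \<le> (2 * infsum (dep i) ?D) * a i / 2"
    proof (rule gibbs_avg_perturb[OF fin])
      fix \<sigma> \<tau> :: "int \<Rightarrow> 'e"
      have "\<bar>?h \<eta> \<sigma> - ?h \<eta> \<tau>\<bar> \<le> infsum a {j. cupd {i} \<sigma> \<eta> j \<noteq> cupd {i} \<tau> \<eta> j}" by (rule lip)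
      also have "\<dots> \<le> infsum a {i}"
        by (rule infsum_mono2) (auto simp: cupd_def a aA)
      finally show "\<bar>?h \<eta> \<sigma> - ?h \<eta> \<tau>\<bar> \<le> a i" by simp
    next
      fix \<sigma> :: "int \<Rightarrow> 'e"
      have "\<bar>?u \<xi> \<sigma> - ?u \<eta> \<sigma>\<bar> \<le> 2 * infsum (dep i) (?D - {i})"
        using hamiltonian_diff_le[of "cupd {i} \<sigma> \<xi>" i "cupd {i} \<sigma> \<eta>"] unfolding D
        by (simp add: cupd_def)
      also have "\<dots> \<le> 2 * infsum (dep i) ?D"
        by (intro mult_left_mono infsum_mono2 dep_summable dep_nonneg) auto
      finally show "\<bar>?u \<xi> \<sigma> - ?u \<eta> \<sigma>\<bar> \<le> 2 * infsum (dep i) ?D" .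
    qed
    ultimately show ?thesis unfolding gibbs_kernel_def infsum_dep_update[OF a(1)]
      by (simp add: algebra_simps)
  qed
  moreover have "0 \<le> dep_update i a j" for j unfolding dep_update_def
    using a(2) dep_nonneg by auto
  ultimately show ?thesis unfolding hamming_lipschitz_def
    using dep_update_summable[OF a(1)] gibbs_kernel_measurable[OF _ meas] by auto
qed

text \<open>Resampling a site \<open>i\<close> removes the mass \<open>a i\<close> and hands out at most \<open>c * a i\<close> to the other
  sites; a site not yet visited never loses mass.\<close>
lemma sweep:
  assumes g: "gibbs Phi \<mu>" "gibbs Phi \<nu>" and f: "hamming_lipschitz a f" and J: "finite J"
  shows "\<exists>b h. hamming_lipschitz b h \<and> (\<integral>\<omega>. h \<omega> \<partial>\<mu>) = (\<integral>\<omega>. f \<omega> \<partial>\<mu>) \<and> (\<integral>\<omega>. h \<omega> \<partial>\<nu>) = (\<integral>\<omega>. f \<omega> \<partial>\<nu>)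
    \<and> infsum b UNIV \<le> infsum a UNIV - (1 - c) * (\<Sum>j\<in>J. a j) \<and> (\<forall>j. j \<notin> J \<longrightarrow> a j \<le> b j)"
  using J
proof (induction J rule: finite_induct)
  case empty
  show ?case by (rule exI[of _ a], rule exI[of _ f]) (simp add: f)
next
  case (insert i J)
  then obtain b h where bh: "hamming_lipschitz b h"
      "(\<integral>\<omega>. h \<omega> \<partial>\<mu>) = (\<integral>\<omega>. f \<omega> \<partial>\<mu>)" "(\<integral>\<omega>. h \<omega> \<partial>\<nu>) = (\<integral>\<omega>. f \<omega> \<partial>\<nu>)"
      "infsum b UNIV \<le> infsum a UNIV - (1 - c) * (\<Sum>j\<in>J. a j)" "\<And>j. j \<notin> J \<Longrightarrow> a j \<le> b j"
    by blast
  have b: "b summable_on UNIV" "\<And>j. 0 \<le> b j" "h \<in> borel_measurable Xsp"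
    using bh(1) unfolding hamming_lipschitz_def by auto
  have I: "(\<integral>\<omega>. gibbs_kernel Phi {i} h \<omega> \<partial>\<kappa>) = (\<integral>\<omega>. h \<omega> \<partial>\<kappa>)" if "gibbs Phi \<kappa>" for \<kappa>
    by (rule gibbs_integral_kernel[OF that _ b(3) hamming_lipschitz_bounded(2)[OF bh(1), where \<eta>=undefined]]) simp
  have "infsum (dep_update i b) UNIV \<le> infsum b UNIV - (1 - c) * b i"
    by (rule infsum_dep_update_le[OF b(1,2)])
  moreover have "(1 - c) * a i \<le> (1 - c) * b i"
    using bh(5)[OF insert.hyps(2)] c_less by (intro mult_left_mono) auto
  ultimately have "infsum (dep_update i b) UNIV \<le> infsum a UNIV - (1 - c) * (\<Sum>j\<in>insert i J. a j)"
    using bh(4) insert.hyps by (simp add: algebra_simps)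
  moreover have "a j \<le> dep_update i b j" if "j \<notin> insert i J" for j
    using that bh(5)[of j] mult_nonneg_nonneg[OF b(2)[of i] dep_nonneg[of i j]] unfolding dep_update_def by auto
  ultimately show ?case
    using gibbs_kernel_hamming_lipschitz[OF bh(1), of i] I[OF g(1)] I[OF g(2)] bh(2,3) by auto
qed

text \<open>A sweep over finitely many sites that carry almost all the weight multiplies the total
  by \<open>c\<close>, up to a small error, and preserves both integrals. The induction generalises
  \<open>a\<close> and \<open>f\<close> because each sweep replaces the test function.\<close>

lemma integral_diff_contraction:
  assumes g: "gibbs Phi \<mu>" "gibbs Phi \<nu>" and f: "hamming_lipschitz a f"
  shows "\<bar>(\<integral>\<omega>. f \<omega> \<partial>\<mu>) - (\<integral>\<omega>. f \<omega> \<partial>\<nu>)\<bar> \<le> 2 * c ^ n * infsum a UNIV"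
  using f
proof (induction n arbitrary: a f)
  case 0
  have a: "a summable_on UNIV" "\<And>j. 0 \<le> a j" "f \<in> borel_measurable Xsp"
    using 0 unfolding hamming_lipschitz_def by auto
  \<comment> \<open>Every Gibbs integral of \<open>f\<close> is within the total weight of the value
    at one arbitrary configuration. Comparing two measures through that value gives the factor
    2.\<close>
  have "\<bar>(\<integral>\<omega>. f \<omega> \<partial>\<kappa>) - f undefined\<bar> \<le> infsum a UNIV" if "gibbs Phi \<kappa>" for \<kappa>
  proof -
    interpret prob_space \<kappa> using gibbs_prob_space[OF that] .
    have "integrable \<kappa> f"
    proof (rule integrable_bounded_real)
      show "f \<in> borel_measurable \<kappa>" unfolding gibbs_borel_measurable[OF that] by (rule a(3))
    qed (rule hamming_lipschitz_bounded(2)[OF 0])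
    then have "\<bar>(\<integral>\<omega>. f \<omega> \<partial>\<kappa>) - (\<integral>\<omega>. f undefined \<partial>\<kappa>)\<bar> \<le> infsum a UNIV"
      by (rule integral_diff_abs_le) (simp, rule hamming_lipschitz_bounded(1)[OF 0])
    then show ?thesis by (simp add: prob_space)
  qed
  from this[OF g(1)] this[OF g(2)] show ?case by simp
next
  case (Suc n)
  have a: "a summable_on UNIV" "\<And>j. 0 \<le> a j"
    using Suc.prems unfolding hamming_lipschitz_def by auto
  show ?case
  proof (rule field_le_epsilon)
    fix \<epsilon> :: real assume "\<epsilon> > 0"
    \<comment> \<open>Half of \<open>\<epsilon>\<close>, since the induction hypothesis multiplies
      the weight missed by the sweep by \<open>2 * c ^ n\<close>, which is at most 2.\<close>
    define e where "e = \<epsilon> / 2"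
    have "e > 0" using \<open>\<epsilon> > 0\<close> unfolding e_def by simp
    obtain J where J: "finite J" "infsum a UNIV \<le> (\<Sum>j\<in>J. a j) + e"
    proof -
      obtain J where "finite J" "dist (sum a J) (infsum a UNIV) \<le> e"
        using infsum_finite_approximation[OF a(1) \<open>e > 0\<close>] by blast
      then have "infsum a UNIV \<le> sum a J + e" unfolding dist_real_def by linarith
      with \<open>finite J\<close> show thesis by (rule that)
    qed
    obtain b h where bh: "hamming_lipschitz b h"
      "(\<integral>\<omega>. h \<omega> \<partial>\<mu>) = (\<integral>\<omega>. f \<omega> \<partial>\<mu>)" "(\<integral>\<omega>. h \<omega> \<partial>\<nu>) = (\<integral>\<omega>. f \<omega> \<partial>\<nu>)"
      "infsum b UNIV \<le> infsum a UNIV - (1 - c) * (\<Sum>j\<in>J. a j)"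
      using sweep[OF g Suc.prems J(1)] by blast
    have "(1 - c) * (infsum a UNIV - e) \<le> (1 - c) * (\<Sum>j\<in>J. a j)"
      using J(2) c_less by (intro mult_left_mono) auto
    moreover have "(1 - c) * e \<le> 1 * e" using c_nonneg \<open>e > 0\<close> by (intro mult_right_mono) auto
    ultimately have le: "infsum b UNIV \<le> c * infsum a UNIV + e"
      using bh(4) by (simp add: algebra_simps)
    have "\<bar>(\<integral>\<omega>. f \<omega> \<partial>\<mu>) - (\<integral>\<omega>. f \<omega> \<partial>\<nu>)\<bar> \<le> 2 * c ^ n * infsum b UNIV"
      using Suc.IH[OF bh(1)] bh(2,3) by simp
    also have "\<dots> \<le> 2 * c ^ n * (c * infsum a UNIV + e)"
      using le c_nonneg by (intro mult_left_mono) auto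
    also have "\<dots> \<le> 2 * c ^ Suc n * infsum a UNIV + \<epsilon>"
    proof -
      have "c ^ n * \<epsilon> \<le> 1 * \<epsilon>"
        using c_nonneg c_less \<open>\<epsilon> > 0\<close> by (intro mult_right_mono power_le_one) auto
      moreover have "2 * c ^ n * (c * infsum a UNIV + e) = 2 * c ^ Suc n * infsum a UNIV + c ^ n * \<epsilon>"
        unfolding e_def by (simp add: algebra_simps)
      ultimately show ?thesis by linarith
    qed
    finally show "\<bar>(\<integral>\<omega>. f \<omega> \<partial>\<mu>) - (\<integral>\<omega>. f \<omega> \<partial>\<nu>)\<bar> \<le> 2 * c ^ Suc n * infsum a UNIV + \<epsilon>" .
  qed
qed

lemma integral_gibbs_unique:
  assumes g: "gibbs Phi \<mu>" "gibbs Phi \<nu>" and f: "hamming_lipschitz a f"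
  shows "(\<integral>\<omega>. f \<omega> \<partial>\<mu>) = (\<integral>\<omega>. f \<omega> \<partial>\<nu>)"
proof -
  have "(\<lambda>n. c ^ n) \<longlonglongrightarrow> 0" using c_nonneg c_less by (intro LIMSEQ_power_zero) simp
  from tendsto_mult[OF tendsto_mult[OF tendsto_const[of 2] this] tendsto_const[of "infsum a UNIV"]]
  have "(\<lambda>n. 2 * c ^ n * infsum a UNIV) \<longlonglongrightarrow> 0" by simp
  then have "\<bar>(\<integral>\<omega>. f \<omega> \<partial>\<mu>) - (\<integral>\<omega>. f \<omega> \<partial>\<nu>)\<bar> \<le> 0"
    by (rule LIMSEQ_le_const) (use integral_diff_contraction[OF g f] in auto)
  then show ?thesis by simp
qed

text \<open>The indicator of a cylinder is Lipschitz: it changes by at most 1, and only if a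
  coordinate in the finite set \<open>J\<close> changes. Cylinders determine a probability on the
  product space.\<close>

lemma gibbs_unique:
  assumes g: "gibbs Phi \<mu>" "gibbs Phi \<nu>"
  shows "\<mu> = \<nu>"
proof (rule measure_eqI_PiM_infinite)
  interpret \<mu>: prob_space \<mu> using gibbs_prob_space[OF g(1)] .
  interpret \<nu>: prob_space \<nu> using gibbs_prob_space[OF g(2)] .
  show "finite_measure \<mu>" by (rule \<mu>.finite_measure_axioms)
  show s: "sets \<mu> = PiM UNIV (\<lambda>_. count_space UNIV)" "sets \<nu> = PiM UNIV (\<lambda>_. count_space UNIV)"
    using gibbs_sets[OF g(1)] gibbs_sets[OF g(2)] unfolding Xsp_def by auto
  fix A :: "int \<Rightarrow> 'e set" and J :: "int set" assume J: "finite J"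
  let ?C = "prod_emb UNIV (\<lambda>_. count_space UNIV) J (Pi\<^sub>E J A) :: (int \<Rightarrow> 'e) set"
  have C: "?C = {\<omega>. \<forall>j\<in>J. \<omega> j \<in> A j}" by (auto simp: prod_emb_def PiE_iff)
  have CX: "?C \<in> sets Xsp" unfolding Xsp_def by (rule sets_PiM_I) (use J in auto)
  have "hamming_lipschitz (\<lambda>j. if j \<in> J then 1 else 0) (indicator ?C)"
    unfolding hamming_lipschitz_def
  proof (intro conjI allI)
    have sm: "(\<lambda>j. if j \<in> J then 1 else 0 :: real) summable_on A" for A
      by (subst summable_on_cong_neutral[where T="J \<inter> A" and g="\<lambda>_. 1"]) (use J in auto)
    show "(\<lambda>j. if j \<in> J then 1 else 0 :: real) summable_on UNIV" by (rule sm)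
    show "indicat_real ?C \<in> borel_measurable Xsp" using CX by measurable
    fix \<xi> \<eta> :: "int \<Rightarrow> 'e"
    show "\<bar>indicator ?C \<xi> - indicator ?C \<eta>\<bar> \<le> (\<Sum>\<^sub>\<infinity>j\<in>{j. \<xi> j \<noteq> \<eta> j}. if j \<in> J then 1 else 0 :: real)"
    proof (cases "\<forall>j\<in>J. \<xi> j = \<eta> j")
      case True
      then have "indicator ?C \<xi> = (indicator ?C \<eta> :: real)" unfolding C by (auto simp: indicator_def)
      then show ?thesis by (auto intro: infsum_nonneg)
    next
      case False
      then obtain j where j: "j \<in> J" "\<xi> j \<noteq> \<eta> j" by auto
      have "\<bar>indicator ?C \<xi> - indicator ?C \<eta>\<bar> \<le> (1::real)" by (auto simp: indicator_def)
      also have "\<dots> = (\<Sum>j\<in>{j}. if j \<in> J then 1 else 0)" using j by simp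
      also have "\<dots> \<le> (\<Sum>\<^sub>\<infinity>j\<in>{j. \<xi> j \<noteq> \<eta> j}. if j \<in> J then 1 else 0 :: real)"
        by (rule finite_sum_le_infsum[OF sm]) (use j in auto)
      finally show ?thesis .
    qed
  qed simp
  from integral_gibbs_unique[OF g this] have "measure \<mu> ?C = measure \<nu> ?C"
    using CX gibbs_sets[OF g(1)] gibbs_sets[OF g(2)]
    by (simp add: gibbs_space[OF g(1)] gibbs_space[OF g(2)])
  then show "emeasure \<mu> ?C = emeasure \<nu> ?C"
    by (simp add: \<mu>.emeasure_eq_measure \<nu>.emeasure_eq_measure)
qed

end

section \<open>Removing finitely many interaction terms\<close>

lemma supnorm_0 [simp]: "supnorm (\<lambda>_. 0) = 0"
  unfolding supnorm_def by simp

lemma osc_0 [simp]: "osc (\<lambda>_. 0) = 0"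
  unfolding osc_def by simp

lemma dobrushin_interactionE:
  assumes "interaction Phi" "UAC Phi" "dobrushin Phi"
  obtains c where "dobrushin_interaction Phi c"
proof -
  obtain c where c: "c < 1" "\<And>i. (\<lambda>L. (real (card L) - 1) * osc (Phi L)) summable_on {L. finite L \<and> i \<in> L}"
    "\<And>i. (1/2) * (\<Sum>\<^sub>\<infinity>L\<in>{L. finite L \<and> i \<in> L}. (real (card L) - 1) * osc (Phi L)) \<le> c"
    using assms(3) unfolding dobrushin_def by blast
  have "dobrushin_interaction Phi c"
    by unfold_locales (rule assms c)+
  then show thesis by (rule that)
qed

text \<open>Setting terms to zero can only decrease \<open>supnorm\<close> and \<open>osc\<close>,
  so both summability conditions survive with the old bounds.\<close>

lemma (in dobrushin_interaction) dobrushin_subinteraction: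
  assumes sub: "\<And>V. Phi' V = Phi V \<or> Phi' V = (\<lambda>_. 0)"
  shows "dobrushin_interaction Phi' c"
proof unfold_locales
  show int': "interaction Phi'" unfolding interaction_def
  proof (intro allI impI)
    fix L :: "int set" and \<omega> \<eta> :: "int \<Rightarrow> 'e" assume "finite L" "\<forall>i\<in>L. \<omega> i = \<eta> i"
    then have "Phi L \<omega> = Phi L \<eta>" using int unfolding interaction_def by blast
    then show "Phi' L \<omega> = Phi' L \<eta>" using sub[of L] by auto
  qed
  have le: "supnorm (Phi' V) \<le> supnorm (Phi V)" "osc (Phi' V) \<le> osc (Phi V)" if "finite V" for V
    using sub[of V] interaction_supnorm_nonneg[OF int that] interaction_osc_nonneg[OF int that] by auto
  obtain C where C: "\<And>i. (\<lambda>V. supnorm (Phi V)) summable_on {V. finite V \<and> i \<in> V}"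
      "\<And>i. (\<Sum>\<^sub>\<infinity>V\<in>{V. finite V \<and> i \<in> V}. supnorm (Phi V)) \<le> C"
    using uac unfolding UAC_def by blast
  have s: "(\<lambda>V. supnorm (Phi' V)) summable_on {V. finite V \<and> i \<in> V}" for i
    by (rule summable_on_comparison_test[OF C(1)]) (auto intro: le interaction_supnorm_nonneg int')
  have "(\<Sum>\<^sub>\<infinity>V\<in>{V. finite V \<and> i \<in> V}. supnorm (Phi' V)) \<le> C" for i
    by (rule order_trans[OF infsum_mono[OF s C(1)] C(2)]) (auto intro: le)
  then show "UAC Phi'" unfolding UAC_def using s by blast
  show "c < 1" by (rule c_less)
  fix i :: int
  \<comment> \<open>\<open>V\<close> contains \<open>i\<close>, so it is nonempty and the weight is
    nonnegative; multiplying by it therefore preserves inequalities.\<close>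
  have card: "0 \<le> real (card V) - 1" if "V \<in> {V. finite V \<and> i \<in> V}" for V
    using that card_gt_0_iff[of V] by auto
  have t: "(\<lambda>L. (real (card L) - 1) * osc (Phi' L)) summable_on {L. finite L \<and> i \<in> L}"
  proof (rule summable_on_comparison_test[OF dob_summable])
    fix V assume V: "V \<in> {L. finite L \<and> i \<in> L}"
    then have fin: "finite V" by simp
    show "(real (card V) - 1) * osc (Phi' V) \<le> (real (card V) - 1) * osc (Phi V)"
      by (rule mult_left_mono[OF le(2)[OF fin] card[OF V]])
    show "0 \<le> (real (card V) - 1) * osc (Phi' V)"
      by (rule mult_nonneg_nonneg[OF card[OF V] interaction_osc_nonneg[OF int' fin]])
  qed
  then show "(\<lambda>L. (real (card L) - 1) * osc (Phi' L)) summable_on {L. finite L \<and> i \<in> L}" .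
  have "(\<Sum>\<^sub>\<infinity>L\<in>{L. finite L \<and> i \<in> L}. (real (card L) - 1) * osc (Phi' L))
      \<le> (\<Sum>\<^sub>\<infinity>L\<in>{L. finite L \<and> i \<in> L}. (real (card L) - 1) * osc (Phi L))"
    by (rule infsum_mono[OF t dob_summable], rule mult_left_mono[OF le(2) card]) simp_all
  then show "(1/2) * (\<Sum>\<^sub>\<infinity>L\<in>{L. finite L \<and> i \<in> L}. (real (card L) - 1) * osc (Phi' L)) \<le> c"
    using dob_le[of i] by linarith
qed

definition drop_terms :: "'e interaction \<Rightarrow> int set set \<Rightarrow> 'e interaction" where
  "drop_terms Phi K V = (if V \<in> K then (\<lambda>_. 0) else Phi V)"

lemma Phik_eq_drop_terms: "Phik Phi Lam k = drop_terms Phi (Lam ` {1..k})"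
  unfolding Phik_def drop_terms_def by auto

lemma Psi0_eq_drop_terms: "Psi0 Phi = drop_terms Phi crossing"
  unfolding Psi0_def drop_terms_def by auto

lemma (in dobrushin_interaction) dobrushin_drop_terms: "dobrushin_interaction (drop_terms Phi K) c"
  by (rule dobrushin_subinteraction) (auto simp: drop_terms_def)

lemma gibbs_kernel_invariant:
  "gibbs_kernel Phi L f (cupd L \<sigma> \<eta>) = gibbs_kernel Phi L f \<eta>"
  unfolding gibbs_kernel_def by simp

lemma gibbs_kernel_idem:
  assumes "finite L"
  shows "gibbs_kernel Phi L (gibbs_kernel Phi L f) \<eta> = gibbs_kernel Phi L f \<eta>"
  unfolding gibbs_kernel_def[of Phi L "gibbs_kernel Phi L f"] gibbs_kernel_invariant
  using assms by (simp add: gibbs_avg_const)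

lemma (in prob_space) prob_space_density_real:
  fixes f :: "'a \<Rightarrow> real"
  assumes "integrable M f" "\<And>x. 0 \<le> f x" "(\<integral>x. f x \<partial>M) = 1"
  shows "prob_space (density M f)"
proof
  have "emeasure (density M f) (space (density M f)) = (\<integral>\<^sup>+x. ennreal (f x) \<partial>M)"
    using assms(1) by (subst emeasure_density) (auto intro!: nn_integral_cong)
  also have "\<dots> = ennreal (\<integral>x. f x \<partial>M)" using assms by (intro nn_integral_eq_integral) auto
  finally show "emeasure (density M f) (space (density M f)) = 1" using assms(3) by simp
qed

lemma measure_density_real:
  fixes f :: "'a \<Rightarrow> real"
  assumes "f \<in> borel_measurable M" "\<And>x. 0 \<le> f x" "A \<in> sets M"
  shows "measure (density M f) A = (\<integral>x. f x * indicator A x \<partial>M)"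
proof -
  have "measure (density M f) A = (\<integral>x. indicator A x \<partial>density M f)"
    using assms(3) by (simp add: sets.Int_space_eq2)
  also have "\<dots> = (\<integral>x. f x * indicator A x \<partial>M)"
    using assms by (subst integral_real_density) auto
  finally show ?thesis .
qed

section \<open>Tilting a Gibbs measure by the removed energy\<close>

context uac_interaction
begin

definition energy :: "int set set \<Rightarrow> (int \<Rightarrow> 'e) \<Rightarrow> real" where
  "energy K \<omega> = (\<Sum>V\<in>K. Phi V \<omega>)"

lemma energy_measurable: "\<forall>V\<in>K. finite V \<Longrightarrow> energy K \<in> borel_measurable Xsp"
  unfolding energy_def[abs_def] by (intro borel_measurable_sum interaction_measurable int) auto

lemma energy_abs_le:
  assumes "\<forall>V\<in>K. finite V"
  shows "\<bar>energy K \<omega>\<bar> \<le> (\<Sum>V\<in>K. supnorm (Phi V))"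
  unfolding energy_def
  by (rule order_trans[OF sum_abs]) (use assms in \<open>auto intro: sum_mono interaction_abs_le_supnorm int\<close>)

lemma hamiltonian_drop_terms:
  assumes L: "finite L" and K: "finite K" "\<forall>V\<in>K. finite V"
  shows "hamiltonian Phi L \<omega> = hamiltonian (drop_terms Phi K) L \<omega> + energy {V\<in>K. V \<inter> L \<noteq> {}} \<omega>"
proof -
  let ?A = "{V. finite V \<and> V \<inter> L \<noteq> {}}"
  note s = interaction_abs_summable[OF L, of \<omega>]
  have eq: "{V\<in>?A. V \<in> K} = {V\<in>K. V \<inter> L \<noteq> {}}" using K by auto
  have 1: "(\<lambda>V. if V \<notin> K then Phi V \<omega> else 0) summable_on ?A"
    by (rule infsum_real_indicator(1)[OF s])
  have 2: "(\<lambda>V. if V \<in> K then Phi V \<omega> else 0) summable_on ?A"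
    "(\<Sum>\<^sub>\<infinity>V\<in>?A. if V \<in> K then Phi V \<omega> else 0) = energy {V\<in>K. V \<inter> L \<noteq> {}} \<omega>"
    using infsum_real_indicator[OF s, of "\<lambda>V. V \<in> K"] K(1) unfolding eq energy_def by auto
  have "hamiltonian Phi L \<omega>
      = (\<Sum>\<^sub>\<infinity>V\<in>?A. (if V \<notin> K then Phi V \<omega> else 0) + (if V \<in> K then Phi V \<omega> else 0))"
    unfolding hamiltonian_def by (rule infsum_cong) auto
  also have "\<dots> = (\<Sum>\<^sub>\<infinity>V\<in>?A. if V \<notin> K then Phi V \<omega> else 0) + energy {V\<in>K. V \<inter> L \<noteq> {}} \<omega>"
    unfolding infsum_add[OF 1 2(1)] 2(2) ..
  also have "(\<Sum>\<^sub>\<infinity>V\<in>?A. if V \<notin> K then Phi V \<omega> else 0) = hamiltonian (drop_terms Phi K) L \<omega>"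
    unfolding hamiltonian_def drop_terms_def by (rule infsum_cong) auto
  finally show ?thesis .
qed

text \<open>The plus sign in \<open>exp (energy K \<omega>)\<close> cancels the removed terms in the
  Gibbs weight. Terms of \<open>K\<close> disjoint from \<open>L\<close> see only the boundary
  condition and come out as the constant \<open>exp ?R\<close>. The kernel with terms removed is
  thus a ratio of two averages for \<open>Phi\<close>, as in Bayes' rule.\<close>

lemma gibbs_kernel_tilt:
  assumes L: "finite L" and K: "finite K" "\<forall>V\<in>K. finite V"
  shows "gibbs_kernel Phi L (\<lambda>\<omega>. g \<omega> * exp (energy K \<omega>)) \<eta>
    = gibbs_kernel (drop_terms Phi K) L g \<eta> * gibbs_kernel Phi L (\<lambda>\<omega>. exp (energy K \<omega>)) \<eta>"
proof -
  let ?S = "L \<rightarrow>\<^sub>E (UNIV :: 'e set)"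
  let ?H = "\<lambda>\<sigma>. hamiltonian Phi L (cupd L \<sigma> \<eta>)"
  let ?H' = "\<lambda>\<sigma>. hamiltonian (drop_terms Phi K) L (cupd L \<sigma> \<eta>)"
  let ?R = "energy {V\<in>K. V \<inter> L = {}} \<eta>"
  have split: "energy K \<omega> = energy {V\<in>K. V \<inter> L \<noteq> {}} \<omega> + energy {V\<in>K. V \<inter> L = {}} \<omega>" for \<omega>
  proof -
    have "K = {V\<in>K. V \<inter> L \<noteq> {}} \<union> {V\<in>K. V \<inter> L = {}}" by auto
    then have "energy K \<omega> = energy ({V\<in>K. V \<inter> L \<noteq> {}} \<union> {V\<in>K. V \<inter> L = {}}) \<omega>" by simp
    also have "\<dots> = energy {V\<in>K. V \<inter> L \<noteq> {}} \<omega> + energy {V\<in>K. V \<inter> L = {}} \<omega>"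
      unfolding energy_def using K(1) by (intro sum.union_disjoint) auto
    finally show ?thesis .
  qed
  have R: "energy {V\<in>K. V \<inter> L = {}} (cupd L \<sigma> \<eta>) = ?R" for \<sigma>
    unfolding energy_def
  proof (rule sum.cong)
    fix V assume V: "V \<in> {V\<in>K. V \<inter> L = {}}"
    then have "\<forall>i\<in>V. cupd L \<sigma> \<eta> i = \<eta> i" by (auto simp: cupd_def)
    then show "Phi V (cupd L \<sigma> \<eta>) = Phi V \<eta>" using int K(2) V unfolding interaction_def by auto
  qed simp
  have e: "exp (energy K (cupd L \<sigma> \<eta>)) * exp (- ?H \<sigma>) = exp ?R * exp (- ?H' \<sigma>)" for \<sigma>
    unfolding exp_add[symmetric] by (simp add: hamiltonian_drop_terms[OF L K] split R)
  have pos: "(\<Sum>\<sigma>\<in>?S. exp (- ?H \<sigma>)) > 0" "(\<Sum>\<sigma>\<in>?S. exp (- ?H' \<sigma>)) > 0"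
    using L by (auto intro!: gibbs_avg_partition_pos)
  have eq: "gibbs_kernel Phi L (\<lambda>\<omega>. h \<omega> * exp (energy K \<omega>)) \<eta>
      = exp ?R * (\<Sum>\<sigma>\<in>?S. h (cupd L \<sigma> \<eta>) * exp (- ?H' \<sigma>)) / (\<Sum>\<sigma>\<in>?S. exp (- ?H \<sigma>))" for h
    unfolding gibbs_kernel_def gibbs_avg_def mult.assoc e by (simp add: sum_distrib_left algebra_simps)
  have eq1: "gibbs_kernel Phi L (\<lambda>\<omega>. exp (energy K \<omega>)) \<eta>
      = exp ?R * (\<Sum>\<sigma>\<in>?S. exp (- ?H' \<sigma>)) / (\<Sum>\<sigma>\<in>?S. exp (- ?H \<sigma>))"
    using eq[of "\<lambda>_. 1"] by simp
  show ?thesis unfolding eq eq1 gibbs_kernel_def[of "drop_terms Phi K"] gibbs_avg_def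
    using pos by simp
qed

lemma gibbs_tilt:
  assumes g: "gibbs Phi \<mu>" and K: "finite K" "\<forall>V\<in>K. finite V"
    and drop: "uac_interaction (drop_terms Phi K)"
  shows "gibbs (drop_terms Phi K)
    (density \<mu> (\<lambda>\<omega>. exp (energy K \<omega>) / (\<integral>\<xi>. exp (energy K \<xi>) \<partial>\<mu>)))"
proof -
  interpret prob_space \<mu> using gibbs_prob_space[OF g] .
  interpret D: uac_interaction "drop_terms Phi K" by (rule drop)
  define B where "B = (\<Sum>V\<in>K. supnorm (Phi V))"
  define Z where "Z = (\<integral>\<xi>. exp (energy K \<xi>) \<partial>\<mu>)"
  define f where "f \<omega> = exp (energy K \<omega>) / Z" for \<omega>
  have E: "(\<lambda>\<omega>. exp (energy K \<omega>)) \<in> borel_measurable Xsp"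
    using energy_measurable[OF K(2)] by measurable
  have EB: "\<bar>exp (energy K \<omega>)\<bar> \<le> exp B" for \<omega>
    using energy_abs_le[OF K(2), of \<omega>] unfolding B_def by (simp add: abs_le_iff)
  have ii: "integrable \<mu> h" if "h \<in> borel_measurable Xsp" "\<And>x. \<bar>h x\<bar> \<le> C"
    for h :: "_ \<Rightarrow> real" and C
    by (rule integrable_bounded_real[of h C]) (use that in \<open>simp_all only: gibbs_borel_measurable[OF g]\<close>)
  have Z: "Z > 0"
  proof -
    have "(\<integral>\<xi>. exp (- B) \<partial>\<mu>) \<le> Z" unfolding Z_def
    proof (rule integral_mono)
      show "integrable \<mu> (\<lambda>\<omega>. exp (energy K \<omega>))" by (rule ii[OF E EB])
      show "exp (- B) \<le> exp (energy K \<omega>)" for \<omega>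
        using energy_abs_le[OF K(2), of \<omega>] unfolding B_def by (simp add: abs_le_iff)
    qed simp
    then have "exp (- B) \<le> Z" by (simp add: prob_space)
    then show ?thesis using exp_gt_zero[of "- B"] by linarith
  qed
  have fX: "f \<in> borel_measurable Xsp" unfolding f_def[abs_def] using E by measurable
  then have fm: "f \<in> borel_measurable \<mu>" by (simp only: gibbs_borel_measurable[OF g])
  have f0: "0 \<le> f \<omega>" for \<omega> unfolding f_def using Z by simp
  have f1: "integrable \<mu> f" "(\<integral>\<omega>. f \<omega> \<partial>\<mu>) = 1"
    unfolding f_def[abs_def] using ii[OF E EB] Z by (auto simp: Z_def)
  \<comment> \<open>By the Gibbs equation for \<open>\<mu>\<close>, either integrand may first be
    averaged by the kernel of \<open>Phi\<close>. The tilting identity then turns both into the same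
    function, since the kernel of \<open>drop_terms Phi K\<close> fixes what it has already
    averaged.\<close>
  have key: "(\<integral>\<omega>. gamma (drop_terms Phi K) L A \<omega> * exp (energy K \<omega>) \<partial>\<mu>)
      = (\<integral>\<omega>. indicator A \<omega> * exp (energy K \<omega>) \<partial>\<mu>)" if L: "finite L" and A: "A \<in> sets Xsp" for L A
  proof -
    let ?k = "gibbs_kernel (drop_terms Phi K) L (indicator A)"
    have I: "(\<integral>\<omega>. gibbs_kernel Phi L (\<lambda>\<omega>. h \<omega> * exp (energy K \<omega>)) \<omega> \<partial>\<mu>)
        = (\<integral>\<omega>. h \<omega> * exp (energy K \<omega>) \<partial>\<mu>)"
      if h: "h \<in> borel_measurable Xsp" "\<And>\<omega>. \<bar>h \<omega>\<bar> \<le> 1" for h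
    proof (rule gibbs_integral_kernel[OF g L])
      show "(\<lambda>\<omega>. h \<omega> * exp (energy K \<omega>)) \<in> borel_measurable Xsp" using h(1) E by measurable
      show "\<bar>h \<omega> * exp (energy K \<omega>)\<bar> \<le> 1 * exp B" for \<omega>
        unfolding abs_mult by (intro mult_mono h EB) auto
    qed
    have iA: "indicat_real A \<in> borel_measurable Xsp" using A by measurable
    have iA1: "\<bar>indicat_real A \<omega>\<bar> \<le> 1" for \<omega> by (auto simp: indicator_def)
    have "(\<integral>\<omega>. ?k \<omega> * exp (energy K \<omega>) \<partial>\<mu>)
        = (\<integral>\<omega>. gibbs_kernel Phi L (\<lambda>\<omega>. ?k \<omega> * exp (energy K \<omega>)) \<omega> \<partial>\<mu>)"
      by (rule I[symmetric, OF D.gibbs_kernel_measurable[OF L iA] gibbs_kernel_abs_le[OF L iA1]])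
    also have "\<dots> = (\<integral>\<omega>. gibbs_kernel Phi L (\<lambda>\<omega>. indicator A \<omega> * exp (energy K \<omega>)) \<omega> \<partial>\<mu>)"
      by (simp only: gibbs_kernel_tilt[OF L K] gibbs_kernel_idem[OF L])
    also have "\<dots> = (\<integral>\<omega>. indicator A \<omega> * exp (energy K \<omega>) \<partial>\<mu>)" by (rule I[OF iA iA1])
    finally show ?thesis unfolding gamma_eq_gibbs_kernel .
  qed
  have "gibbs (drop_terms Phi K) (density \<mu> f)"
    unfolding gibbs_def
  proof (intro conjI allI impI ballI)
    show "prob_space (density \<mu> f)" by (rule prob_space_density_real[OF f1(1) f0 f1(2)])
    show "sets (density \<mu> f) = sets Xsp" using gibbs_sets[OF g] by simp
    fix L :: "int set" and A :: "(int \<Rightarrow> 'e) set" assume L: "finite L" and A: "A \<in> sets Xsp"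
    have A': "A \<in> sets \<mu>" using A gibbs_sets[OF g] by simp
    have gm: "gamma (drop_terms Phi K) L A \<in> borel_measurable \<mu>"
      unfolding gamma_eq_gibbs_kernel gibbs_borel_measurable[OF g]
      by (rule D.gibbs_kernel_measurable[OF L]) (use A in measurable)
    have "measure (density \<mu> f) A = (\<integral>\<omega>. (indicator A \<omega> * exp (energy K \<omega>)) / Z \<partial>\<mu>)"
      by (subst measure_density_real[OF fm f0 A']) (simp add: f_def mult.commute)
    also have "\<dots> = (\<integral>\<omega>. (gamma (drop_terms Phi K) L A \<omega> * exp (energy K \<omega>)) / Z \<partial>\<mu>)"
      using key[OF L A] by simp
    also have "\<dots> = (\<integral>\<omega>. f \<omega> * gamma (drop_terms Phi K) L A \<omega> \<partial>\<mu>)"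
      unfolding f_def by (simp add: mult.commute)
    also have "\<dots> = (\<integral>\<omega>. gamma (drop_terms Phi K) L A \<omega> \<partial>density \<mu> f)"
      using fm gm f0 by (subst integral_real_density) auto
    finally show "measure (density \<mu> f) A = (\<integral>\<omega>. gamma (drop_terms Phi K) L A \<omega> \<partial>density \<mu> f)" .
  qed
  then show ?thesis unfolding f_def Z_def .
qed

end

section \<open>Entropy, uniform integrability and setwise limits\<close>

text \<open>Where the density \<open>f\<close> exceeds \<open>C\<close>, \<open>f * ln C\<close> is
  at most \<open>f * ln f\<close>; elsewhere \<open>f * ln f\<close> is at least -1, whence the
  summand 1. The integral of \<open>f * ln f\<close> is the relative entropy: the mean of
  \<open>F\<close> under the tilted measure minus \<open>ln Z\<close>, where \<open>ln Z\<close> is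
  at least the mean of \<open>F\<close> under \<open>M\<close>. The bound \<open>B\<close> serves
  integrability and stays out of the estimate, so it may grow with the number of removed
  terms.\<close>

lemma (in prob_space) unif_integrable_entropy_bound:
  fixes F :: "'a \<Rightarrow> real"
  defines "Z \<equiv> (\<integral>x. exp (F x) \<partial>M)"
  assumes F: "F \<in> borel_measurable M" and B: "\<And>x. x \<in> space M \<Longrightarrow> \<bar>F x\<bar> \<le> B"
    and C: "C > 1"
  shows "ln C * (\<integral>x. indicator {x. exp (F x) / Z > C} x * (exp (F x) / Z) \<partial>M)
    \<le> (\<integral>x. exp (F x) / Z * F x \<partial>M) - (\<integral>x. F x \<partial>M) + 1"
proof -
  define f where "f x = exp (F x) / Z" for x
  have int: "integrable M h" if "h \<in> borel_measurable M" "\<And>x. x \<in> space M \<Longrightarrow> \<bar>h x\<bar> \<le> b"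
    for h :: "'a \<Rightarrow> real" and b
    using that by (intro integrable_const_bound[where B=b]) auto
  have FB: "F x \<le> B" "- B \<le> F x" if "x \<in> space M" for x using B[OF that] by (auto simp: abs_le_iff)
  have iF: "integrable M F" by (rule int[OF F B])
  have eF: "integrable M (\<lambda>x. exp (F x))"
    by (rule int[of _ "exp B"]) (use F FB in auto)
  define m where "m = (\<integral>x. F x \<partial>M)"
  \<comment> \<open>Jensen: the tangent of \<open>exp\<close> at the mean\<close>
  have "(\<integral>x. exp m * (1 + (F x - m)) \<partial>M) \<le> Z" unfolding Z_def
  proof (rule integral_mono)
    show "exp m * (1 + (F x - m)) \<le> exp (F x)" for x
    proof -
      have "exp m * (1 + (F x - m)) \<le> exp m * exp (F x - m)"
        by (intro mult_left_mono exp_ge_add_one_self) simp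
      then show ?thesis by (simp add: exp_diff)
    qed
  qed (use iF eF in auto)
  moreover have "(\<integral>x. exp m * (1 + (F x - m)) \<partial>M) = exp m"
    using iF by (simp add: prob_space m_def)
  ultimately have Zm: "exp m \<le> Z" by simp
  then have Z: "Z > 0" using exp_gt_zero[of m] by linarith
  have lnZ: "m \<le> ln Z" using Zm Z by (metis exp_gt_zero ln_exp ln_le_cancel_iff)
  have f0: "f x > 0" for x unfolding f_def using Z by simp
  have lnf: "ln (f x) = F x - ln Z" for x unfolding f_def using Z by (simp add: ln_div)
  have f: "f \<in> borel_measurable M" unfolding f_def[abs_def] using F by measurable
  have i_f: "integrable M f" "(\<integral>x. f x \<partial>M) = 1"
    unfolding f_def[abs_def] using eF Z by (auto simp: Z_def)
  have fFb: "integrable M (\<lambda>x. f x * F x)"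
  proof (rule int[of _ "exp B / Z * B"])
    show "(\<lambda>x. f x * F x) \<in> borel_measurable M" using f F by measurable
    show "\<bar>f x * F x\<bar> \<le> exp B / Z * B" if "x \<in> space M" for x
      unfolding abs_mult f_def using FB[OF that] B[OF that] Z
      by (intro mult_mono) (auto simp: divide_right_mono)
  qed
  have pw: "ln C * (indicator {x. f x > C} x * f x) \<le> f x * F x - ln Z * f x + 1" for x
  proof -
    \<comment> \<open>This leads to \<open>t * ln t \<ge> t - 1\<close>, and \<open>t - 1\<close>
      exceeds -1 for positive \<open>t\<close>.\<close>
    have "1 - inverse (f x) \<le> ln (f x)"
      using f0[of x] ln_le_minus_one[of "inverse (f x)"] by (simp add: ln_inverse)
    then have "f x * (1 - inverse (f x)) \<le> f x * ln (f x)"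
      using f0[of x] by (intro mult_left_mono) auto
    then have x: "- 1 \<le> f x * ln (f x)" using f0[of x] by (simp add: right_diff_distrib)
    have eq: "f x * F x - ln Z * f x = f x * ln (f x)" unfolding lnf by (simp add: algebra_simps)
    show ?thesis
    proof (cases "f x > C")
      case True
      then have "ln C \<le> ln (f x)" using C by simp
      then have "f x * ln C \<le> f x * ln (f x)" using f0[of x] by (intro mult_left_mono) auto
      then show ?thesis using True unfolding eq by (simp add: mult.commute)
    qed (use x eq in auto)
  qed
  have "(\<integral>x. ln C * (indicator {x. f x > C} x * f x) \<partial>M) \<le> (\<integral>x. f x * F x - ln Z * f x + 1 \<partial>M)"
  proof (rule integral_mono[OF _ _ pw])
    show "integrable M (\<lambda>x. f x * F x - ln Z * f x + 1)" using fFb i_f by simp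
    have "integrable M (\<lambda>x. indicator {x. f x > C} x * f x)"
    proof (rule Bochner_Integration.integrable_bound[OF i_f(1)])
      have "(\<lambda>x. if f x > C then f x else 0) \<in> borel_measurable M" using f by measurable
      also have "(\<lambda>x. if f x > C then f x else 0) = (\<lambda>x. indicator {x. f x > C} x * f x)"
        by (auto simp: indicator_def)
      finally show "(\<lambda>x. indicator {x. f x > C} x * f x) \<in> borel_measurable M" .
    qed (auto simp: indicator_def)
    then show "integrable M (\<lambda>x. ln C * (indicator {x. f x > C} x * f x))" by simp
  qed
  also have "(\<integral>x. f x * F x - ln Z * f x + 1 \<partial>M) = (\<integral>x. f x * F x \<partial>M) - ln Z + 1"
    using fFb i_f by (simp add: prob_space)
  also have "\<dots> \<le> (\<integral>x. f x * F x \<partial>M) - m + 1" using lnZ by simp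
  finally show ?thesis unfolding f_def m_def by simp
qed

section \<open>From uniform integrability to setwise limits\<close>

lemma (in finite_measure) unif_integrable_imp_unif_abs_cont:
  assumes ui: "unif_integrable M F" and "\<epsilon> > 0"
  obtains \<delta> where "\<delta> > 0"
    "\<And>A n. A \<in> sets M \<Longrightarrow> measure M A < \<delta> \<Longrightarrow> (\<integral>x. indicator A x * \<bar>F n x\<bar> \<partial>M) \<le> \<epsilon>"
proof -
  have int: "integrable M (F n)" for n using ui unfolding unif_integrable_def by blast
  obtain C where C: "\<And>n. (\<integral>x. indicator {x. \<bar>F n x\<bar> > C} x * \<bar>F n x\<bar> \<partial>M) \<le> \<epsilon> / 2"
    using ui \<open>\<epsilon> > 0\<close> unfolding unif_integrable_def by (metis half_gt_zero)
  show thesis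
  proof
    \<comment> \<open>On \<open>A\<close> the values up to \<open>\<bar>C\<bar>\<close> cost at most
      \<open>\<bar>C\<bar> * measure M A\<close>, those above \<open>C\<close> at most half of
      \<open>\<epsilon>\<close>. \<open>C\<close> comes without a sign, hence the absolute value;
      adding 1 keeps the denominator positive.\<close>
    show "\<epsilon> / (2 * (\<bar>C\<bar> + 1)) > 0" using \<open>\<epsilon> > 0\<close> by simp
    fix A n assume A: "A \<in> sets M" and small: "measure M A < \<epsilon> / (2 * (\<bar>C\<bar> + 1))"
    have 1: "integrable M (\<lambda>x. indicator {x. \<bar>F n x\<bar> > C} x * \<bar>F n x\<bar>)"
    proof (rule Bochner_Integration.integrable_bound[OF int[of n]])
      have "(\<lambda>x. if \<bar>F n x\<bar> > C then \<bar>F n x\<bar> else 0) \<in> borel_measurable M"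
        using borel_measurable_integrable[OF int[of n]] by measurable
      also have "(\<lambda>x. if \<bar>F n x\<bar> > C then \<bar>F n x\<bar> else 0)
          = (\<lambda>x. indicator {x. \<bar>F n x\<bar> > C} x * \<bar>F n x\<bar>)" by (auto simp: indicator_def)
      finally show "(\<lambda>x. indicator {x. \<bar>F n x\<bar> > C} x * \<bar>F n x\<bar>) \<in> borel_measurable M" .
    qed (auto simp: indicator_def)
    have 2: "integrable M (\<lambda>x. \<bar>C\<bar> * indicator A x)"
      using A by (intro integrable_mult_right integrable_real_indicator) (auto simp: less_top[symmetric])
    have "(\<integral>x. indicator A x * \<bar>F n x\<bar> \<partial>M)
        \<le> (\<integral>x. \<bar>C\<bar> * indicator A x + indicator {x. \<bar>F n x\<bar> > C} x * \<bar>F n x\<bar> \<partial>M)"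
    proof (rule integral_mono)
      show "integrable M (\<lambda>x. indicator A x * \<bar>F n x\<bar>)"
        using integrable_mult_indicator[OF A integrable_abs[OF int[of n]]] by simp
    qed (use 1 2 in \<open>auto simp: indicator_def\<close>)
    also have "\<dots> = \<bar>C\<bar> * measure M A + (\<integral>x. indicator {x. \<bar>F n x\<bar> > C} x * \<bar>F n x\<bar> \<partial>M)"
      using 1 2 A by (subst Bochner_Integration.integral_add) (auto simp: sets.Int_space_eq2)
    also have "\<dots> \<le> (\<bar>C\<bar> + 1) * (\<epsilon> / (2 * (\<bar>C\<bar> + 1))) + \<epsilon> / 2"
      using small by (intro add_mono mult_mono C) auto
    also have "\<dots> = \<epsilon>" by (simp add: field_simps)
    finally show "(\<integral>x. indicator A x * \<bar>F n x\<bar> \<partial>M) \<le> \<epsilon>" .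
  qed
qed

text \<open>A cylinder is given by a finite set of sites and one subset of the finite alphabet at
  each of them. Countability permits a diagonal subsequence along which all cylinder probabilities
  converge.\<close>

lemma countable_prod_algebra:
  fixes M :: "'i::countable \<Rightarrow> ('e::finite) measure"
  shows "countable (prod_algebra UNIV M)"
proof (rule countable_subset)
  let ?C = "\<lambda>J X. prod_emb UNIV M J (Pi\<^sub>E J X)"
  show "prod_algebra UNIV M \<subseteq> (\<Union>J\<in>Collect finite. ?C J ` (J \<rightarrow>\<^sub>E UNIV))"
  proof
    fix A assume "A \<in> prod_algebra UNIV M"
    then obtain J X where J: "finite J" and A: "A = ?C J X" by (rule prod_algebraE) 
    have "A = ?C J (restrict X J)" unfolding A by (simp cong: PiE_cong)
    moreover have "restrict X J \<in> J \<rightarrow>\<^sub>E UNIV" by auto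
    ultimately show "A \<in> (\<Union>J\<in>Collect finite. ?C J ` (J \<rightarrow>\<^sub>E UNIV))" using J by blast
  qed
  show "countable (\<Union>J\<in>Collect finite. ?C J ` (J \<rightarrow>\<^sub>E UNIV))"
    by (intro countable_UN countable_Collect_finite countable_image countable_finite)
      (auto intro!: finite_PiE)
qed

text \<open>Sequential compactness in the style of Dunford and Pettis, for measures instead of
  densities. Beyond the diagonal argument on \<open>G\<close> there is one idea, used twice: along
  sets decreasing to the empty set, \<open>ac\<close> makes the measures small uniformly in
  \<open>k\<close>. This carries convergence through disjoint unions and makes the limit countably
  additive.\<close>

lemma setwise_convergent_subsequence:
  fixes N :: "nat \<Rightarrow> 'a measure"
  assumes \<mu>: "prob_space \<mu>" and N: "\<And>k. prob_space (N k)" "\<And>k. sets (N k) = sets \<mu>"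
    and G: "sets \<mu> = sigma_sets (space \<mu>) G" "Int_stable G" "G \<subseteq> Pow (space \<mu>)" "countable G"
    and ac: "\<And>\<epsilon>. \<epsilon> > 0 \<Longrightarrow>
      \<exists>\<delta>>0. \<forall>A\<in>sets \<mu>. measure \<mu> A < \<delta> \<longrightarrow> (\<forall>k. measure (N k) A \<le> \<epsilon>)"
  obtains r \<nu> where "strict_mono (r :: nat \<Rightarrow> nat)" "prob_space \<nu>" "sets \<nu> = sets \<mu>"
    "absolutely_continuous \<mu> \<nu>"
    "\<forall>A\<in>sets \<mu>. (\<lambda>k. measure (N (r k)) A) \<longlonglongrightarrow> measure \<nu> A"
proof -
  interpret \<mu>: prob_space \<mu> by (rule \<mu>)
  interpret N: prob_space "N k" for k by (rule N(1))
  have space: "space (N k) = space \<mu>" for k by (rule sets_eq_imp_space_eq[OF N(2)])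
  obtain r where r: "strict_mono (r :: nat \<Rightarrow> nat)"
    and conv: "\<And>A. A \<in> G \<Longrightarrow> \<exists>l. (\<lambda>k. measure (N (r k)) A) \<longlonglongrightarrow> l"
    using function_convergent_subsequence[of G "\<lambda>k A. measure (N k) A" 1] G(4) by auto
  have all: "convergent (\<lambda>k. measure (N (r k)) A)" if "A \<in> sets \<mu>" for A
    using G(2,3) that[unfolded G(1)]
  proof (induction rule: sigma_sets_induct_disjoint)
    case (basic A)
    then show ?case using conv unfolding convergent_def by blast
  next
    case empty
    then show ?case by (simp add: convergent_const)
  next
    case (compl A)
    have "measure (N (r k)) (space \<mu> - A) = 1 - measure (N (r k)) A" for k
      using compl(1) N(2) G(1) N.prob_compl[of A "r k"] by (simp add: space)
    then show ?case using convergent_diff[OF convergent_const[of 1] compl(2)] by simp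
  next
    case (union A)
    have A: "A i \<in> sets \<mu>" for i using union(2) G(1) by auto
    show ?case
    proof (rule Cauchy_convergent, rule metric_CauchyI)
      fix e :: real assume "e > 0"
      then obtain \<delta> where \<delta>: "\<delta> > 0"
          "\<And>B k. B \<in> sets \<mu> \<Longrightarrow> measure \<mu> B < \<delta> \<Longrightarrow> measure (N k) B \<le> e / 4"
        using ac[of "e / 4"] by auto
      \<comment> \<open>By disjointness the tails \<open>?T n\<close> decrease to the empty set. One
        cut \<open>n\<close> works for all \<open>k\<close>, and the finite sum in front converges
        by the induction hypothesis.\<close>
      let ?T = "\<lambda>n. \<Union>i\<in>{n..}. A i"
      have T: "?T n \<in> sets \<mu>" for n using A by auto
      have "(\<lambda>n. measure \<mu> (?T n)) \<longlonglongrightarrow> measure \<mu> (\<Inter>n. ?T n)"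
        using T by (intro \<mu>.finite_Lim_measure_decseq) (auto simp: decseq_def, meson atLeast_iff order_trans)
      moreover have "(\<Inter>n. ?T n) = {}"
      proof (rule ccontr)
        assume "(\<Inter>n. ?T n) \<noteq> {}"
        then obtain x where x: "\<And>n. x \<in> ?T n" by blast
        obtain i where i: "x \<in> A i" using x[of 0] by auto
        obtain j where "j \<ge> Suc i" "x \<in> A j" using x[of "Suc i"] by auto
        with i show False using disjoint_family_onD[OF union(1), of i j] by auto
      qed
      ultimately have "(\<lambda>n. measure \<mu> (?T n)) \<longlonglongrightarrow> 0" by simp
      from order_tendstoD(2)[OF this \<delta>(1)] obtain n where n: "measure \<mu> (?T n) < \<delta>"
        by (auto simp: eventually_sequentially)
      have split: "measure (N k) (\<Union>i. A i) = (\<Sum>i<n. measure (N k) (A i)) + measure (N k) (?T n)" for k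
      proof -
        have "(\<Union>i. A i) = (\<Union>i<n. A i) \<union> ?T n" by (auto, meson atLeast_iff lessThan_iff not_less)
        moreover have "(\<Union>i<n. A i) \<inter> ?T n = {}"
        proof (rule equals0I)
          fix x assume "x \<in> (\<Union>i<n. A i) \<inter> ?T n"
          then obtain i j where "i < n" "x \<in> A i" "n \<le> j" "x \<in> A j" by auto
          then show False using disjoint_family_onD[OF union(1), of i j] by auto
        qed
        ultimately have "measure (N k) (\<Union>i. A i) = measure (N k) (\<Union>i<n. A i) + measure (N k) (?T n)"
          using A T N(2) by (simp add: N.finite_measure_Union)
        moreover have "measure (N k) (\<Union>i<n. A i) = (\<Sum>i<n. measure (N k) (A i))"
          using A N(2) union(1) by (intro N.finite_measure_finite_Union) (auto simp: disjoint_family_on_def)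
        ultimately show ?thesis by simp
      qed
      have "convergent (\<lambda>k. \<Sum>i<n. measure (N (r k)) (A i))"
        by (rule convergent_sum) (rule union(3))
      then have "Cauchy (\<lambda>k. \<Sum>i<n. measure (N (r k)) (A i))" by (rule convergent_Cauchy)
      then obtain K where K: "\<And>k l. k \<ge> K \<Longrightarrow> l \<ge> K \<Longrightarrow>
          dist (\<Sum>i<n. measure (N (r k)) (A i)) (\<Sum>i<n. measure (N (r l)) (A i)) < e / 4"
        using metric_CauchyD[of _ "e / 4"] \<open>e > 0\<close> by (meson divide_pos_pos zero_less_numeral)
      show "\<exists>K. \<forall>k\<ge>K. \<forall>l\<ge>K. dist (measure (N (r k)) (\<Union>i. A i)) (measure (N (r l)) (\<Union>i. A i)) < e"
      proof (intro exI allI impI)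
        fix k l assume kl: "k \<ge> K" "l \<ge> K"
        have "measure (N (r k)) (?T n) \<le> e / 4" "measure (N (r l)) (?T n) \<le> e / 4"
          using \<delta>(2)[OF T n] by auto
        then show "dist (measure (N (r k)) (\<Union>i. A i)) (measure (N (r l)) (\<Union>i. A i)) < e"
          using K[OF kl] measure_nonneg[of "N (r k)" "?T n"] measure_nonneg[of "N (r l)" "?T n"] \<open>e > 0\<close>
          unfolding split dist_real_def by linarith
      qed
    qed
  qed
  define L where "L A = lim (\<lambda>k. measure (N (r k)) A)" for A
  have L: "(\<lambda>k. measure (N (r k)) A) \<longlonglongrightarrow> L A" if "A \<in> sets \<mu>" for A
    unfolding L_def using all[OF that] by (simp add: convergent_LIMSEQ_iff)
  have L0: "0 \<le> L A" if "A \<in> sets \<mu>" for A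
    by (rule LIMSEQ_le_const[OF L[OF that]]) auto
  have Lle: "L A \<le> e" if "A \<in> sets \<mu>" "\<And>k. measure (N k) A \<le> e" for A e
    by (rule LIMSEQ_le_const2[OF L[OF that(1)]]) (use that(2) in auto)
  have Ladd: "L (A \<union> B) = L A + L B" if "A \<in> sets \<mu>" "B \<in> sets \<mu>" "A \<inter> B = {}" for A B
  proof (rule LIMSEQ_unique)
    show "(\<lambda>k. measure (N (r k)) (A \<union> B)) \<longlonglongrightarrow> L (A \<union> B)" using that by (intro L) auto
    have "measure (N (r k)) (A \<union> B) = measure (N (r k)) A + measure (N (r k)) B" for k
      using that N(2) by (intro N.finite_measure_Union) auto
    then show "(\<lambda>k. measure (N (r k)) (A \<union> B)) \<longlonglongrightarrow> L A + L B"
      using tendsto_add[OF L[OF that(1)] L[OF that(2)]] by simp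
  qed
  have Lempty: "L {} = 0" unfolding L_def by simp
  have ca: "countably_additive (sets \<mu>) (\<lambda>A. ennreal (L A))"
  proof (rule sets.empty_continuous_imp_countably_additive)
    show "positive (sets \<mu>) (\<lambda>A. ennreal (L A))" unfolding positive_def by (simp add: Lempty)
    show "additive (sets \<mu>) (\<lambda>A. ennreal (L A))" unfolding additive_def
      by (auto simp: Ladd L0 ennreal_plus)
    fix A :: "nat \<Rightarrow> 'a set" assume A: "range A \<subseteq> sets \<mu>" "decseq A" "(\<Inter>i. A i) = {}"
    have A': "A i \<in> sets \<mu>" for i using A(1) by auto
    have m0: "(\<lambda>i. measure \<mu> (A i)) \<longlonglongrightarrow> 0"
      using \<mu>.finite_Lim_measure_decseq[OF A(1,2)] A(3) by simp
    have "(\<lambda>i. L (A i)) \<longlonglongrightarrow> 0"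
    proof (rule LIMSEQ_I)
      fix e :: real assume "e > 0"
      then obtain \<delta> where \<delta>: "\<delta> > 0"
          "\<And>B k. B \<in> sets \<mu> \<Longrightarrow> measure \<mu> B < \<delta> \<Longrightarrow> measure (N k) B \<le> e / 2"
        using ac[of "e / 2"] by auto
      from order_tendstoD(2)[OF m0 \<delta>(1)] obtain n where n: "\<And>i. i \<ge> n \<Longrightarrow> measure \<mu> (A i) < \<delta>"
        by (auto simp: eventually_sequentially)
      have "norm (L (A i) - 0) < e" if "i \<ge> n" for i
        using Lle[OF A' \<delta>(2)[OF A' n[OF that]]] L0[OF A'] \<open>e > 0\<close> by fastforce
      then show "\<exists>n. \<forall>i\<ge>n. norm (L (A i) - 0) < e" by blast
    qed
    then show "(\<lambda>i. ennreal (L (A i))) \<longlonglongrightarrow> 0"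
      using tendsto_ennrealI by fastforce
  qed simp
  define \<nu> where "\<nu> = measure_of (space \<mu>) (sets \<mu>) (\<lambda>A. ennreal (L A))"
  have s\<nu>: "sets \<nu> = sets \<mu>" "space \<nu> = space \<mu>" unfolding \<nu>_def by auto
  have em: "emeasure \<nu> A = ennreal (L A)" if "A \<in> sets \<mu>" for A
    unfolding \<nu>_def using that ca
    by (intro emeasure_measure_of_sigma sets.sigma_algebra_axioms) (auto simp: positive_def Lempty)
  have m: "measure \<nu> A = L A" if "A \<in> sets \<mu>" for A
    using em[OF that] L0[OF that] by (simp add: measure_def)
  have "L (space \<mu>) = 1"
  proof (rule LIMSEQ_unique[OF L])
    have "measure (N (r k)) (space \<mu>) = 1" for k using N.prob_space[of "r k"] unfolding space .
    then show "(\<lambda>k. measure (N (r k)) (space \<mu>)) \<longlonglongrightarrow> 1" by simp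
  qed simp
  then have "prob_space \<nu>" by (intro prob_spaceI) (simp add: s\<nu> em)
  moreover have "absolutely_continuous \<mu> \<nu>"
    unfolding absolutely_continuous_def
  proof
    fix A assume "A \<in> null_sets \<mu>"
    then have A: "A \<in> sets \<mu>" "measure \<mu> A = 0" by (auto simp: measure_def)
    have "L A \<le> 0 + e" if e: "e > 0" for e
      using ac[OF e] A by (force intro: Lle)
    then have "L A \<le> 0" by (rule field_le_epsilon)
    then have "L A = 0" using L0[OF A(1)] by simp
    then show "A \<in> null_sets \<nu>" using A em[OF A(1)] s\<nu> by auto
  qed
  ultimately show thesis using that[OF r _ s\<nu>(1)] L m by auto
qed

section \<open>The sequence of crossing removals\<close>

text \<open>Unlike weak convergence, setwise convergence needs no continuity of \<open>g\<close>:
  one step function uniformly within \<open>e / 4\<close> of \<open>g\<close> serves all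
  \<open>N k\<close> and \<open>\<nu>\<close> at once.\<close>

lemma setwise_convergence_imp_integral_tendsto:
  fixes N :: "nat \<Rightarrow> 'a measure" and g :: "'a \<Rightarrow> real"
  assumes N: "\<And>k. prob_space (N k)" "\<And>k. sets (N k) = sets \<nu>" and \<nu>: "prob_space \<nu>"
    and conv: "\<And>A. A \<in> sets \<nu> \<Longrightarrow> (\<lambda>k. measure (N k) A) \<longlonglongrightarrow> measure \<nu> A"
    and g: "g \<in> borel_measurable \<nu>" and B: "\<And>x. x \<in> space \<nu> \<Longrightarrow> \<bar>g x\<bar> \<le> B"
  shows "(\<lambda>k. \<integral>x. g x \<partial>N k) \<longlonglongrightarrow> (\<integral>x. g x \<partial>\<nu>)"
proof (rule LIMSEQ_I)
  fix e :: real assume e: "e > 0"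
  obtain I c A where I: "finite (I::int set)" and A: "\<And>m. A m \<in> sets \<nu>"
    and ap: "\<And>x. x \<in> space \<nu> \<Longrightarrow> \<bar>g x - (\<Sum>m\<in>I. c m * indicator (A m) x)\<bar> \<le> e / 4"
    by (rule borel_measurable_step_approx[OF g B, of "e / 4"]) (use e in auto)
  define s where "s x = (\<Sum>m\<in>I. c m * indicator (A m) x)" for x
  have s: "s \<in> borel_measurable \<nu>" unfolding s_def[abs_def] using A by measurable
  have sB: "\<bar>s x\<bar> \<le> B + e / 4" if "x \<in> space \<nu>" for x
    using ap[OF that] B[OF that] unfolding s_def by linarith
  have close: "\<bar>(\<integral>x. g x \<partial>M) - (\<integral>x. s x \<partial>M)\<bar> \<le> e / 4"
    and step: "(\<integral>x. s x \<partial>M) = (\<Sum>m\<in>I. c m * measure M (A m))"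
    if M: "prob_space M" "sets M = sets \<nu>" for M
  proof -
    interpret prob_space M by (rule M(1))
    have sp: "space M = space \<nu>" by (rule sets_eq_imp_space_eq[OF M(2)])
    have bm: "borel_measurable M = borel_measurable \<nu>" by (rule measurable_cong_sets[OF M(2) refl])
    show "\<bar>(\<integral>x. g x \<partial>M) - (\<integral>x. s x \<partial>M)\<bar> \<le> e / 4"
    proof (rule integral_diff_abs_le)
      show "integrable M g"
        by (rule integrable_bounded_real[of _ B]) (simp_all only: bm g sp B)
      show "integrable M s"
        by (rule integrable_bounded_real[of _ "B + e / 4"]) (simp_all only: bm s sp sB)
      show "\<bar>g x - s x\<bar> \<le> e / 4" if "x \<in> space M" for x
        using ap that unfolding s_def sp by blast
    qed
    show "(\<integral>x. s x \<partial>M) = (\<Sum>m\<in>I. c m * measure M (A m))"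
      unfolding s_def by (rule integral_step[OF I]) (simp only: M(2) A)
  qed
  have "(\<lambda>k. \<integral>x. s x \<partial>N k) \<longlonglongrightarrow> (\<integral>x. s x \<partial>\<nu>)"
    unfolding step[OF N] step[OF \<nu> refl]
    by (intro tendsto_sum tendsto_mult_left conv A)
  from LIMSEQ_D[OF this, of "e / 4"] obtain K where
    K: "\<And>k. k \<ge> K \<Longrightarrow> \<bar>(\<integral>x. s x \<partial>N k) - (\<integral>x. s x \<partial>\<nu>)\<bar> < e / 4" using e by auto
  have "norm ((\<integral>x. g x \<partial>N k) - (\<integral>x. g x \<partial>\<nu>)) < e" if "k \<ge> K" for k
    using K[OF that] close[OF N, of k] close[OF \<nu> refl] e unfolding real_norm_def by linarith
  then show "\<exists>K. \<forall>k\<ge>K. norm ((\<integral>x. g x \<partial>N k) - (\<integral>x. g x \<partial>\<nu>)) < e" by blast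
qed

text \<open>\<open>Lam\<close> enumerates from 1, hence \<open>Suc k\<close> in \<open>rho\<close>.
  The supremum over \<open>n\<close> includes \<open>n = 0\<close>.\<close>

locale crossing_removal = dobrushin_interaction Phi c
  for Phi :: "('e::finite) interaction" and c +
  fixes Lam :: "nat \<Rightarrow> int set" and \<mu> :: "(int \<Rightarrow> 'e) measure"
    and \<mu>k :: "nat \<Rightarrow> (int \<Rightarrow> 'e) measure"
  assumes enum: "bij_betw Lam {1..} crossing"
    and mu: "gibbs Phi \<mu>"
    and muk: "\<And>n. gibbs (Phik Phi Lam n) (\<mu>k n)"
    and rho: "summable (\<lambda>k. SUP n. \<bar>\<integral>\<omega>. Phi (Lam (Suc k)) \<omega> \<partial>(\<mu>k n)\<bar>)"
begin

sublocale mu: prob_space \<mu> by (rule gibbs_prob_space[OF mu])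

lemma Lam_image: "Lam ` {1..} = crossing"
  by (rule bij_betw_imp_surj_on[OF enum])

lemma finite_Lam:
  assumes "1 \<le> i"
  shows "finite (Lam i)"
proof -
  have "Lam i \<in> crossing" unfolding Lam_image[symmetric] using assms by simp
  then show ?thesis unfolding crossing_def by simp
qed

lemma finite_Lam_image: "\<forall>V\<in>Lam ` {1..k}. finite V"
  using finite_Lam by auto

lemma energy_Lam: "energy (Lam ` {1..k}) \<omega> = (\<Sum>i=1..k. Phi (Lam i) \<omega>)"
proof -
  have "inj_on Lam {1..k}"
    by (rule inj_on_subset[OF bij_betw_imp_inj_on[OF enum]]) auto
  then show ?thesis unfolding energy_def by (simp add: sum.reindex)
qed

lemma fk_eq: "fk Phi Lam \<mu> k \<omega>
    = exp (energy (Lam ` {1..k}) \<omega>) / (\<integral>\<xi>. exp (energy (Lam ` {1..k}) \<xi>) \<partial>\<mu>)"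
  unfolding fk_def energy_Lam ..

lemma dobrushin_Phik: "dobrushin_interaction (Phik Phi Lam k) c"
  unfolding Phik_eq_drop_terms by (rule dobrushin_drop_terms)

lemma muk_eq_density: "\<mu>k k = density \<mu> (fk Phi Lam \<mu> k)"
proof -
  interpret D: dobrushin_interaction "Phik Phi Lam k" c by (rule dobrushin_Phik)
  have "uac_interaction (drop_terms Phi (Lam ` {1..k}))"
    using D.uac_interaction_axioms unfolding Phik_eq_drop_terms .
  from gibbs_tilt[OF mu _ finite_Lam_image this]
  have "gibbs (Phik Phi Lam k) (density \<mu> (fk Phi Lam \<mu> k))"
    unfolding Phik_eq_drop_terms fk_eq by simp
  then show ?thesis by (rule D.gibbs_unique[OF muk])
qed

text \<open>Places \<open>\<mu>\<close> itself in the sequence, so that the suprema in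
  \<open>rho\<close> also bound integrals against \<open>\<mu>\<close>.\<close>

lemma mu_eq_muk_0: "\<mu> = \<mu>k 0"
proof (rule gibbs_unique[OF mu])
  have "Phik Phi Lam 0 = Phi" unfolding Phik_def by auto
  then show "gibbs Phi (\<mu>k 0)" using muk[of 0] by simp
qed

lemma fk_measurable: "fk Phi Lam \<mu> k \<in> borel_measurable \<mu>"
proof -
  have "energy (Lam ` {1..k}) \<in> borel_measurable \<mu>"
    unfolding gibbs_borel_measurable[OF mu] by (rule energy_measurable[OF finite_Lam_image])
  then show ?thesis unfolding fk_eq[abs_def] by measurable
qed

lemma fk_nonneg: "0 \<le> fk Phi Lam \<mu> k \<omega>"
  unfolding fk_def by (intro divide_nonneg_nonneg Bochner_Integration.integral_nonneg) auto

lemma fk_integrable: "integrable \<mu> (fk Phi Lam \<mu> k)"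
proof -
  let ?E = "energy (Lam ` {1..k})" and ?B = "\<Sum>V\<in>Lam ` {1..k}. supnorm (Phi V)"
  have "integrable \<mu> (\<lambda>\<omega>. exp (?E \<omega>))"
  proof (rule mu.integrable_bounded_real)
    have "?E \<in> borel_measurable \<mu>"
      unfolding gibbs_borel_measurable[OF mu] by (rule energy_measurable[OF finite_Lam_image])
    then show "(\<lambda>\<omega>. exp (?E \<omega>)) \<in> borel_measurable \<mu>" by measurable
    show "\<bar>exp (?E \<omega>)\<bar> \<le> exp ?B" for \<omega>
      using energy_abs_le[OF finite_Lam_image, of k \<omega>] by (simp add: abs_le_iff)
  qed
  then show ?thesis unfolding fk_eq[abs_def] by simp
qed

text \<open>A real supremum dominates the members of a bounded family; the sup norm of the term
  provides the bound.\<close>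

lemma abs_integral_muk_le:
  "\<bar>\<integral>\<omega>. Phi (Lam (Suc i)) \<omega> \<partial>(\<mu>k n)\<bar> \<le> (SUP n. \<bar>\<integral>\<omega>. Phi (Lam (Suc i)) \<omega> \<partial>(\<mu>k n)\<bar>)"
proof (rule cSUP_upper)
  have "\<bar>\<integral>\<omega>. Phi (Lam (Suc i)) \<omega> \<partial>(\<mu>k n)\<bar> \<le> supnorm (Phi (Lam (Suc i)))" for n
    by (rule prob_space.integral_abs_le[OF gibbs_prob_space[OF muk]])
      (rule interaction_abs_le_supnorm[OF int finite_Lam], simp)
  then show "bdd_above (range (\<lambda>n. \<bar>\<integral>\<omega>. Phi (Lam (Suc i)) \<omega> \<partial>(\<mu>k n)\<bar>))" by (rule bdd_aboveI2)
qed simp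

definition R :: real where
  "R = (\<Sum>k. SUP n. \<bar>\<integral>\<omega>. Phi (Lam (Suc k)) \<omega> \<partial>(\<mu>k n)\<bar>)"

text \<open>Each mean is compared with its supremum over \<open>n\<close> before summing, so the
  bound depends neither on \<open>k\<close> nor on \<open>n\<close>. The triangle inequality stays
  outside the integrals, because the sup norms of the terms need not be summable.\<close>

lemma abs_integral_energy_le: "\<bar>\<integral>\<omega>. energy (Lam ` {1..k}) \<omega> \<partial>(\<mu>k n)\<bar> \<le> R"
proof -
  interpret mk: prob_space "\<mu>k n" by (rule gibbs_prob_space[OF muk])
  have int: "integrable (\<mu>k n) (Phi (Lam i))" if "i \<in> {1..k}" for i
  proof (rule mk.integrable_bounded_real)
    have fin: "finite (Lam i)" using that finite_Lam by auto
    show "Phi (Lam i) \<in> borel_measurable (\<mu>k n)"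
      unfolding gibbs_borel_measurable[OF muk] by (rule interaction_measurable[OF int fin])
    show "\<bar>Phi (Lam i) \<omega>\<bar> \<le> supnorm (Phi (Lam i))" for \<omega>
      by (rule interaction_abs_le_supnorm[OF int fin])
  qed
  let ?\<rho> = "\<lambda>i. SUP n. \<bar>\<integral>\<omega>. Phi (Lam (Suc i)) \<omega> \<partial>(\<mu>k n)\<bar>"
  have "\<bar>\<integral>\<omega>. energy (Lam ` {1..k}) \<omega> \<partial>(\<mu>k n)\<bar> = \<bar>\<Sum>i=1..k. \<integral>\<omega>. Phi (Lam i) \<omega> \<partial>(\<mu>k n)\<bar>"
    unfolding energy_Lam using int by (subst Bochner_Integration.integral_sum) auto
  also have "(\<Sum>i=1..k. \<integral>\<omega>. Phi (Lam i) \<omega> \<partial>(\<mu>k n)) = (\<Sum>i<k. \<integral>\<omega>. Phi (Lam (Suc i)) \<omega> \<partial>(\<mu>k n))"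
    using sum.shift_bounds_Suc_ivl[of "\<lambda>i. \<integral>\<omega>. Phi (Lam i) \<omega> \<partial>(\<mu>k n)" 0 k]
    by (simp add: atLeastLessThanSuc_atLeastAtMost lessThan_atLeast0)
  also have "\<bar>\<dots>\<bar> \<le> (\<Sum>i<k. ?\<rho> i)"
    by (rule order_trans[OF sum_abs sum_mono[OF abs_integral_muk_le]])
  also have "\<dots> \<le> R" unfolding R_def
  proof (rule sum_le_suminf[OF rho])
    show "0 \<le> ?\<rho> i" for i by (rule order_trans[OF abs_ge_zero abs_integral_muk_le])
  qed simp
  finally show ?thesis .
qed

lemma R_nonneg: "0 \<le> R"
  by (rule order_trans[OF abs_ge_zero abs_integral_energy_le])

text \<open>The relative entropy of \<open>\<mu>k k\<close> with respect to \<open>\<mu>\<close> is at most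
  \<open>\<integral> F d\<mu>k - \<integral> F d\<mu> \<le> 2 R\<close>, where \<open>F\<close> is the removed energy.\<close>
lemma unif_integrable_fk: "unif_integrable \<mu> (fk Phi Lam \<mu>)"
  unfolding unif_integrable_def
proof (intro conjI allI impI)
  show "integrable \<mu> (fk Phi Lam \<mu> k)" for k by (rule fk_integrable)
  fix \<epsilon> :: real assume \<epsilon>: "\<epsilon> > 0"
  \<comment> \<open>Chosen so that \<open>ln C * \<epsilon>\<close> equals \<open>2 * R + 1\<close>:
    the entropy bound plus the 1 that pays for negative values of \<open>f * ln f\<close>.\<close>
  define C where "C = exp ((2 * R + 1) / \<epsilon>)"
  have C: "C > 1" unfolding C_def using \<epsilon> R_nonneg by simp
  show "\<exists>C. \<forall>k. (\<integral>x. indicator {x. \<bar>fk Phi Lam \<mu> k x\<bar> > C} x * \<bar>fk Phi Lam \<mu> k x\<bar> \<partial>\<mu>) \<le> \<epsilon>"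
  proof (intro exI allI)
    fix k
    let ?E = "energy (Lam ` {1..k})" and ?f = "fk Phi Lam \<mu> k"
    have Em: "?E \<in> borel_measurable \<mu>"
      unfolding gibbs_borel_measurable[OF mu] by (rule energy_measurable[OF finite_Lam_image])
    have "ln C * (\<integral>x. indicator {x. ?f x > C} x * ?f x \<partial>\<mu>)
        \<le> (\<integral>x. ?f x * ?E x \<partial>\<mu>) - (\<integral>x. ?E x \<partial>\<mu>) + 1"
      unfolding fk_eq
      by (rule mu.unif_integrable_entropy_bound[OF Em energy_abs_le[OF finite_Lam_image] C])
    also have "(\<integral>x. ?f x * ?E x \<partial>\<mu>) = (\<integral>x. ?E x \<partial>\<mu>k k)"
      unfolding muk_eq_density
      by (rule integral_real_density[symmetric, OF fk_measurable _ Em]) (simp add: fk_nonneg)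
    also have "\<dots> - (\<integral>x. ?E x \<partial>\<mu>) + 1 \<le> 2 * R + 1"
      using abs_integral_energy_le[where k=k and n=k]
        abs_integral_energy_le[where k=k and n=0, folded mu_eq_muk_0] by linarith
    also have "ln C = (2 * R + 1) / \<epsilon>" unfolding C_def by simp
    finally have "(2 * R + 1) / \<epsilon> * (\<integral>x. indicator {x. ?f x > C} x * ?f x \<partial>\<mu>) \<le> 2 * R + 1" .
    also have "\<dots> = (2 * R + 1) / \<epsilon> * \<epsilon>" using \<epsilon> by simp
    finally have "(\<integral>x. indicator {x. ?f x > C} x * ?f x \<partial>\<mu>) \<le> \<epsilon>"
      by (rule mult_left_le_imp_le) (use \<epsilon> R_nonneg in simp)
    then show "(\<integral>x. indicator {x. \<bar>?f x\<bar> > C} x * \<bar>?f x\<bar> \<partial>\<mu>) \<le> \<epsilon>"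
      by (simp add: fk_nonneg)
  qed
qed

lemma muk_unif_abs_cont:
  assumes "\<epsilon> > 0"
  shows "\<exists>\<delta>>0. \<forall>A\<in>sets \<mu>. measure \<mu> A < \<delta> \<longrightarrow> (\<forall>k. measure (\<mu>k k) A \<le> \<epsilon>)"
proof -
  obtain \<delta> where \<delta>: "\<delta> > 0" "\<And>A k. A \<in> sets \<mu> \<Longrightarrow> measure \<mu> A < \<delta> \<Longrightarrow>
      (\<integral>x. indicator A x * \<bar>fk Phi Lam \<mu> k x\<bar> \<partial>\<mu>) \<le> \<epsilon>"
    using mu.unif_integrable_imp_unif_abs_cont[OF unif_integrable_fk assms] by blast
  have "measure (\<mu>k k) A \<le> \<epsilon>" if "A \<in> sets \<mu>" "measure \<mu> A < \<delta>" for A k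
    using \<delta>(2)[OF that, of k]
    unfolding muk_eq_density measure_density_real[OF fk_measurable fk_nonneg that(1)]
    by (simp add: fk_nonneg mult.commute)
  then show ?thesis using \<delta>(1) by blast
qed

section \<open>Convergence of the specifications and the limiting Gibbs measure\<close>

lemma hamiltonian_Phik_tendsto:
  assumes L: "finite L" and e: "e > 0"
  obtains k0 where "\<And>k \<omega>. k \<ge> k0 \<Longrightarrow>
    \<bar>hamiltonian (Phik Phi Lam k) L \<omega> - hamiltonian (Psi0 Phi) L \<omega>\<bar> \<le> e"
proof -
  let ?A = "{V. finite V \<and> V \<inter> L \<noteq> {}}" and ?s = "\<lambda>V. supnorm (Phi V)"
  let ?T = "\<lambda>F. {V\<in>?A. V \<in> crossing \<and> V \<notin> F}"
  have s: "?s summable_on B" if "B \<subseteq> ?A" for B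
    by (rule summable_on_subset_banach[OF supnorm_summable[OF L] that])
  have nn: "0 \<le> ?s V" if "V \<in> ?A" for V using that by (auto intro: interaction_supnorm_nonneg int)
  \<comment> \<open>\<open>F\<close> holds all but \<open>e\<close> of the total sup norm of the
    crossing terms that meet \<open>L\<close>. Once \<open>k\<close> passes the indices of
    \<open>F\<close>, the two Hamiltonians differ only by terms outside \<open>F\<close>, uniformly
    in the configuration.\<close>
  obtain F where F: "finite F" "F \<subseteq> ?T {}" "dist (sum ?s F) (infsum ?s (?T {})) \<le> e"
    using infsum_finite_approximation[OF s e, of "?T {}"] by blast
  have "infsum ?s (?T {}) = infsum ?s (F \<union> ?T F)"
    by (rule arg_cong[where f="infsum ?s"]) (use F(2) in auto)
  also have "\<dots> = infsum ?s F + infsum ?s (?T F)"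
    by (rule infsum_Un_disjoint) (use F(1) in \<open>auto intro!: s\<close>)
  finally have tail: "infsum ?s (?T F) \<le> e" using F(1,3) by (simp add: dist_real_def)
  have "F \<subseteq> Lam ` {1..}" unfolding Lam_image using F(2) by auto
  then obtain I where I: "I \<subseteq> {1..}" "finite I" "F = Lam ` I"
    using finite_subset_image[OF F(1)] by blast
  obtain k0 where k0: "\<And>i. i \<in> I \<Longrightarrow> i \<le> k0" using I(2) by (meson finite_nat_set_iff_bounded_le)
  have "\<bar>hamiltonian (Phik Phi Lam k) L \<omega> - hamiltonian (Psi0 Phi) L \<omega>\<bar> \<le> e" if k: "k \<ge> k0" for k \<omega>
  proof -
    have "I \<subseteq> {1..k}"
    proof
      fix i assume "i \<in> I"
      then show "i \<in> {1..k}" using I(1) k0[of i] k by auto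
    qed
    then have FK: "F \<subseteq> Lam ` {1..k}" unfolding I(3) by (rule image_mono)
    interpret D: dobrushin_interaction "Phik Phi Lam k" c by (rule dobrushin_Phik)
    interpret P: dobrushin_interaction "Psi0 Phi" c
      unfolding Psi0_eq_drop_terms by (rule dobrushin_drop_terms)
    let ?d = "\<lambda>V. Phik Phi Lam k V \<omega> - Psi0 Phi V \<omega>"
    note su = D.interaction_abs_summable[OF L, of \<omega>] P.interaction_abs_summable[OF L, of \<omega>]
    have diff: "hamiltonian (Phik Phi Lam k) L \<omega> - hamiltonian (Psi0 Phi) L \<omega> = infsum ?d ?A"
      unfolding hamiltonian_def
      using infsum_add[OF su(1) summable_on_uminus[THEN iffD2, OF su(2)]] by (simp add: infsum_uminus)
    have le: "norm (?d V) \<le> (if V \<in> crossing \<and> V \<notin> F then ?s V else 0)" if "V \<in> ?A" for V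
    proof -
      have "Lam ` {1..k} \<subseteq> crossing" unfolding Lam_image[symmetric] by (rule image_mono) auto
      then show ?thesis
        using FK interaction_abs_le_supnorm[OF int, of V \<omega>] nn[OF that] that
        unfolding Phik_def Psi0_def by auto
    qed
    have t: "(\<lambda>V. if V \<in> crossing \<and> V \<notin> F then ?s V else 0) summable_on ?A"
      "(\<Sum>\<^sub>\<infinity>V\<in>?A. if V \<in> crossing \<and> V \<notin> F then ?s V else 0) = infsum ?s (?T F)"
      using infsum_real_indicator[OF s[OF order_refl], of "\<lambda>V. V \<in> crossing \<and> V \<notin> F"] by auto
    have d: "(\<lambda>V. norm (?d V)) summable_on ?A"
      by (rule Infinite_Sum.abs_summable_on_comparison_test'[OF t(1) le])
    have "\<bar>infsum ?d ?A\<bar> \<le> (\<Sum>\<^sub>\<infinity>V\<in>?A. norm (?d V))"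
      using norm_infsum_bound[OF d] by simp
    also have "\<dots> \<le> infsum ?s (?T F)" unfolding t(2)[symmetric] by (rule infsum_mono[OF d t(1) le])
    finally show ?thesis unfolding diff using tail by linarith
  qed
  then show thesis by (rule that)
qed

text \<open>An indicator oscillates by at most 1, so \<open>gibbs_avg_perturb\<close> halves the
  error of the Hamiltonian; an error of \<open>2 * e\<close> is therefore allowed there.\<close>

lemma gamma_Phik_tendsto:
  assumes L: "finite L" and e: "e > 0"
  obtains k0 where "\<And>k \<eta>. k \<ge> k0 \<Longrightarrow> \<bar>gamma (Phik Phi Lam k) L A \<eta> - gamma (Psi0 Phi) L A \<eta>\<bar> \<le> e"
proof -
  obtain k0 where k0: "\<And>k \<omega>. k \<ge> k0 \<Longrightarrow>
      \<bar>hamiltonian (Phik Phi Lam k) L \<omega> - hamiltonian (Psi0 Phi) L \<omega>\<bar> \<le> 2 * e"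
    using hamiltonian_Phik_tendsto[OF L, of "2 * e"] e by auto
  have "\<bar>gamma (Phik Phi Lam k) L A \<eta> - gamma (Psi0 Phi) L A \<eta>\<bar> \<le> (2 * e) * 1 / 2"
    if "k \<ge> k0" for k \<eta>
    unfolding gamma_eq_gibbs_kernel gibbs_kernel_def
    by (rule gibbs_avg_perturb[OF finite_configs[OF L] configs_nonempty _ k0[OF that]])
      (simp add: indicator_def)
  then show thesis by (intro that[of k0]) simp
qed

lemma exists_limit_gibbs:
  obtains \<nu> where "gibbs (Psi0 Phi) \<nu>" "absolutely_continuous \<mu> \<nu>"
proof -
  let ?G = "prod_algebra UNIV (\<lambda>_::int. count_space (UNIV::'e set))"
  have sets: "sets (\<mu>k k) = sets \<mu>" for k using gibbs_sets[OF mu] gibbs_sets[OF muk] by simp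
  have G: "sets \<mu> = sigma_sets (space \<mu>) ?G" "?G \<subseteq> Pow (space \<mu>)"
    unfolding gibbs_sets[OF mu] gibbs_space[OF mu]
    by (simp_all add: Xsp_def sets_PiM)
  obtain r \<nu> where r: "strict_mono (r :: nat \<Rightarrow> nat)" and \<nu>: "prob_space \<nu>" "sets \<nu> = sets \<mu>"
      "absolutely_continuous \<mu> \<nu>"
    and conv: "\<forall>A\<in>sets \<mu>. (\<lambda>j. measure (\<mu>k (r j)) A) \<longlonglongrightarrow> measure \<nu> A"
    by (rule setwise_convergent_subsequence[OF mu.prob_space_axioms gibbs_prob_space[OF muk] sets
        G(1) Int_stable_prod_algebra G(2) countable_prod_algebra muk_unif_abs_cont]) (assumption, rule that)
  interpret P: dobrushin_interaction "Psi0 Phi" c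
    unfolding Psi0_eq_drop_terms by (rule dobrushin_drop_terms)
  have "gibbs (Psi0 Phi) \<nu>" unfolding gibbs_def
  proof (intro conjI allI impI ballI)
    show "prob_space \<nu>" by (rule \<nu>(1))
    show "sets \<nu> = sets Xsp" using \<nu>(2) gibbs_sets[OF mu] by simp
    fix L :: "int set" and A :: "(int \<Rightarrow> 'e) set" assume L: "finite L" and A: "A \<in> sets Xsp"
    have iA: "indicat_real A \<in> borel_measurable Xsp" using A by measurable
    have iA1: "\<bar>indicat_real A \<omega>\<bar> \<le> 1" for \<omega> by (auto simp: indicator_def)
    have gm: "gamma (Psi0 Phi) L A \<in> borel_measurable Xsp"
      unfolding gamma_eq_gibbs_kernel by (rule P.gibbs_kernel_measurable[OF L iA])
    have gb: "\<bar>gamma (Psi0 Phi) L A \<eta>\<bar> \<le> 1" for \<eta>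
      unfolding gamma_eq_gibbs_kernel by (rule gibbs_kernel_abs_le[OF L iA1])
    have bm: "borel_measurable \<nu> = borel_measurable Xsp"
      by (rule measurable_cong_sets) (use \<nu>(2) gibbs_sets[OF mu] in auto)
    have lim: "(\<lambda>j. \<integral>\<eta>. gamma (Psi0 Phi) L A \<eta> \<partial>\<mu>k (r j)) \<longlonglongrightarrow> (\<integral>\<eta>. gamma (Psi0 Phi) L A \<eta> \<partial>\<nu>)"
    proof (rule setwise_convergence_imp_integral_tendsto[OF gibbs_prob_space[OF muk] _ \<nu>(1)])
      show "sets (\<mu>k (r j)) = sets \<nu>" for j using sets \<nu>(2) by simp
      show "(\<lambda>j. measure (\<mu>k (r j)) B) \<longlonglongrightarrow> measure \<nu> B" if "B \<in> sets \<nu>" for B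
        using conv that \<nu>(2) by simp
      show "gamma (Psi0 Phi) L A \<in> borel_measurable \<nu>" unfolding bm by (rule gm)
    qed (rule gb)
    \<comment> \<open>\<open>\<mu>k (r j)\<close> satisfies the Gibbs equation of its own
      \<open>Phik\<close>, and exchanging that kernel for the one of \<open>Psi0 Phi\<close> costs a
      uniformly vanishing error. Combined with \<open>lim\<close>, the equation passes to
      \<open>\<nu>\<close>.\<close>
    have "(\<lambda>j. measure (\<mu>k (r j)) A - (\<integral>\<eta>. gamma (Psi0 Phi) L A \<eta> \<partial>\<mu>k (r j))) \<longlonglongrightarrow> 0"
    proof (rule LIMSEQ_I)
      fix e :: real assume e: "e > 0"
      obtain k0 where k0: "\<And>k \<eta>. k \<ge> k0 \<Longrightarrow>
          \<bar>gamma (Phik Phi Lam k) L A \<eta> - gamma (Psi0 Phi) L A \<eta>\<bar> \<le> e / 2"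
        using gamma_Phik_tendsto[OF L, of "e / 2"] e by auto
      have "norm (measure (\<mu>k (r j)) A - (\<integral>\<eta>. gamma (Psi0 Phi) L A \<eta> \<partial>\<mu>k (r j)) - 0) < e"
        if j: "j \<ge> k0" for j
      proof -
        let ?k = "r j"
        have k: "?k \<ge> k0" using seq_suble[OF r, of j] j by linarith
        interpret mk: prob_space "\<mu>k ?k" by (rule gibbs_prob_space[OF muk])
        interpret D: dobrushin_interaction "Phik Phi Lam ?k" c by (rule dobrushin_Phik)
        have "\<bar>(\<integral>\<eta>. gamma (Phik Phi Lam ?k) L A \<eta> \<partial>\<mu>k ?k) - (\<integral>\<eta>. gamma (Psi0 Phi) L A \<eta> \<partial>\<mu>k ?k)\<bar> \<le> e / 2"
        proof (rule mk.integral_diff_abs_le)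
          show "integrable (\<mu>k ?k) (gamma (Phik Phi Lam ?k) L A)"
          proof (rule mk.integrable_bounded_real)
            show "gamma (Phik Phi Lam ?k) L A \<in> borel_measurable (\<mu>k ?k)"
              unfolding gibbs_borel_measurable[OF muk] gamma_eq_gibbs_kernel
              by (rule D.gibbs_kernel_measurable[OF L iA])
            show "\<bar>gamma (Phik Phi Lam ?k) L A \<eta>\<bar> \<le> 1" for \<eta>
              unfolding gamma_eq_gibbs_kernel by (rule gibbs_kernel_abs_le[OF L iA1])
          qed
          show "integrable (\<mu>k ?k) (gamma (Psi0 Phi) L A)"
          proof (rule mk.integrable_bounded_real)
            show "gamma (Psi0 Phi) L A \<in> borel_measurable (\<mu>k ?k)"
              unfolding gibbs_borel_measurable[OF muk] by (rule gm)
          qed (rule gb)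
        qed (rule k0[OF k])
        then show ?thesis unfolding gibbs_gamma[OF muk L A] using e by simp
      qed
      then show "\<exists>j0. \<forall>j\<ge>j0. norm (measure (\<mu>k (r j)) A
          - (\<integral>\<eta>. gamma (Psi0 Phi) L A \<eta> \<partial>\<mu>k (r j)) - 0) < e" by blast
    qed
    from tendsto_add[OF this lim]
    have "(\<lambda>j. measure (\<mu>k (r j)) A) \<longlonglongrightarrow> (\<integral>\<eta>. gamma (Psi0 Phi) L A \<eta> \<partial>\<nu>)" by simp
    moreover have "A \<in> sets \<mu>" using A gibbs_sets[OF mu] by simp
    then have "(\<lambda>j. measure (\<mu>k (r j)) A) \<longlonglongrightarrow> measure \<nu> A" by (rule bspec[OF conv])
    ultimately show "measure \<nu> A = (\<integral>\<eta>. gamma (Psi0 Phi) L A \<eta> \<partial>\<nu>)"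
      by (intro LIMSEQ_unique)
  qed
  then show thesis using \<nu>(3) by (rule that)
qed

end

theorem theoremF:
  fixes Phi :: "('e::finite) interaction"
    and Lam :: "nat \<Rightarrow> int set"
    and \<mu> :: "(int \<Rightarrow> 'e) measure"
    and \<mu>k :: "nat \<Rightarrow> (int \<Rightarrow> 'e) measure"
  assumes "interaction Phi" and "UAC Phi"
    and enum: "bij_betw Lam {1..} crossing"
    and dob: "dobrushin Phi"
    and mu: "gibbs Phi \<mu>"
    and muk: "\<And>n. gibbs (Phik Phi Lam n) (\<mu>k n)"
    and h2: "summable (\<lambda>k. delta_norm2_sq (Phi (Lam (Suc k))))"
    and h3: "summable (\<lambda>k. SUP n. \<bar>\<integral>\<omega>. Phi (Lam (Suc k)) \<omega> \<partial>(\<mu>k n)\<bar>)"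
  shows "\<exists>\<nu>0. (\<forall>\<nu>. gibbs (Psi0 Phi) \<nu> \<longleftrightarrow> \<nu> = \<nu>0)
            \<and> unif_integrable \<mu> (fk Phi Lam \<mu>)
            \<and> absolutely_continuous \<mu> \<nu>0"
proof -
  obtain c where "dobrushin_interaction Phi c"
    by (rule dobrushin_interactionE[OF assms(1,2) dob])
  then interpret crossing_removal Phi c Lam \<mu> \<mu>k
    by (intro crossing_removal.intro crossing_removal_axioms.intro enum mu muk h3)
  interpret P: dobrushin_interaction "Psi0 Phi" c
    unfolding Psi0_eq_drop_terms by (rule dobrushin_drop_terms)
  obtain \<nu>0 where \<nu>0: "gibbs (Psi0 Phi) \<nu>0" "absolutely_continuous \<mu> \<nu>0"
    by (rule exists_limit_gibbs)
  show ?thesis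
  proof (intro exI[of _ \<nu>0] conjI allI iffI)
    show "\<nu> = \<nu>0" if "gibbs (Psi0 Phi) \<nu>" for \<nu> by (rule P.gibbs_unique[OF that \<nu>0(1)])
    show "gibbs (Psi0 Phi) \<nu>" if "\<nu> = \<nu>0" for \<nu> unfolding that by (rule \<nu>0(1))
  qed (rule unif_integrable_fk \<nu>0(2))+
qed

end
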